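(* Let ${\mathcal B}$ be a family of $n=\deg f$ elements of $L$. Then ${\mathcal B}$ is a $\mathfrak p$-integral basis of $\mathcal O$ (i.e. an $A_\mathfrak p$-basis of $\mathcal O_\mathfrak p$) if and only if ${\mathcal B}$ is $w_S$-semi-orthonormal.
   Context: Let $A$ be a Dedekind domain with fraction field $K$, $\mathfrak p$ a nonzero prime ideal with valuation $v_\mathfrak p$, $A_\mathfrak p$ the localization. Let $f\in A[x]$ be monic irreducible separable of degree $n$, $\theta$ a root, $L=K(\theta)$, $\mathcal O$ the integral closure of $A$ in $L$, $\mathcal O_\mathfrak p$ the integral closure of $A_\mathfrak p$ in $L$, and $S=\{\mathfrak P_1,\dots,\mathfrak P_s\}$ the set of all primes of $\mathcal O$ over $\mathfrak p$, with ramification indices $e_i$ and normalized valuations $v_{\mathfrak P_i}$; $w_{\mathfrak P_i}=v_{\mathfrak P_i}/e_i$, $w_S(z)=\min_iw_{\mathfrak P_i}(z)$. A finite family ${\mathcal B}\subset L$ is $w_S$-semi-reduced if $\lfloor w_S(\sum_b\lambda_bb)\rfloor=\min_b\lfloor w_S(\lambda_bb)\rfloor$ for all $\lambda_b\in K$, and $w_S$-semi-orthonormal if moreover $0\le w_S(b)<1$ for all $b\in{\mathcal B}$. *)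

theory Defs
  imports "HOL-Computational_Algebra.Polynomial_Factorial" "HOL-Library.Extended_Real"
begin

text \<open>All rings and fields live as subsets of one ambient field type 'a
  (which contains L). Ideals are subsets of the ring.\<close>

definition subring :: "'a::field set \<Rightarrow> bool" where
  "subring R \<longleftrightarrow> 0 \<in> R \<and> 1 \<in> R \<and> (\<forall>x\<in>R. \<forall>y\<in>R. x + y \<in> R \<and> x - y \<in> R \<and> x * y \<in> R)"

definition subfield :: "'a::field set \<Rightarrow> bool" where
  "subfield F \<longleftrightarrow> subring F \<and> (\<forall>x\<in>F. x \<noteq> 0 \<longrightarrow> inverse x \<in> F)"

definition ideal_of :: "'a::field set \<Rightarrow> 'a set \<Rightarrow> bool" where
  "ideal_of R I \<longleftrightarrow> I \<subseteq> R \<and> 0 \<in> I \<and> (\<forall>x\<in>I. \<forall>y\<in>I. x + y \<in> I)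
     \<and> (\<forall>x\<in>I. - x \<in> I) \<and> (\<forall>r\<in>R. \<forall>x\<in>I. r * x \<in> I)"

definition prime_ideal_of :: "'a::field set \<Rightarrow> 'a set \<Rightarrow> bool" where
  "prime_ideal_of R P \<longleftrightarrow> ideal_of R P \<and> P \<noteq> R \<and>
     (\<forall>a\<in>R. \<forall>b\<in>R. a * b \<in> P \<longrightarrow> a \<in> P \<or> b \<in> P)"

definition maximal_ideal_of :: "'a::field set \<Rightarrow> 'a set \<Rightarrow> bool" where
  "maximal_ideal_of R P \<longleftrightarrow> ideal_of R P \<and> P \<noteq> R \<and>
     (\<forall>J. ideal_of R J \<and> P \<subseteq> J \<longrightarrow> J = P \<or> J = R)"

definition ideal_gen :: "'a::field set \<Rightarrow> 'a set \<Rightarrow> 'a set" where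
  "ideal_gen R X = \<Inter>{I. ideal_of R I \<and> X \<subseteq> I}"

definition ideal_mult :: "'a::field set \<Rightarrow> 'a set \<Rightarrow> 'a set \<Rightarrow> 'a set" where
  "ideal_mult R I J = ideal_gen R {x * y | x y. x \<in> I \<and> y \<in> J}"

fun ideal_pow :: "'a::field set \<Rightarrow> 'a set \<Rightarrow> nat \<Rightarrow> 'a set" where
  "ideal_pow R P 0 = R"
| "ideal_pow R P (Suc k) = ideal_mult R P (ideal_pow R P k)"

definition integral_over :: "'a::field set \<Rightarrow> 'a \<Rightarrow> bool" where
  "integral_over R x \<longleftrightarrow> (\<exists>g. (\<forall>i. coeff g i \<in> R) \<and> lead_coeff g = 1 \<and> poly g x = 0)"

definition integral_closure :: "'a::field set \<Rightarrow> 'a set \<Rightarrow> 'a set" where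
  "integral_closure R L = {x \<in> L. integral_over R x}"

definition frac_field :: "'a::field set \<Rightarrow> 'a set" where
  "frac_field A = {a / b | a b. a \<in> A \<and> b \<in> A \<and> b \<noteq> 0}"

definition dedekind_domain :: "'a::field set \<Rightarrow> bool" where
  "dedekind_domain A \<longleftrightarrow> subring A
     \<and> (\<forall>I. ideal_of A I \<longrightarrow> (\<exists>F. finite F \<and> F \<subseteq> I \<and> I = ideal_gen A F))
     \<and> (\<forall>x\<in>frac_field A. integral_over A x \<longrightarrow> x \<in> A)
     \<and> (\<forall>P. prime_ideal_of A P \<and> P \<noteq> {0} \<longrightarrow> maximal_ideal_of A P)"

definition localization :: "'a::field set \<Rightarrow> 'a set \<Rightarrow> 'a set" where
  "localization A p = {a / s | a s. a \<in> A \<and> s \<in> A \<and> s \<notin> p}"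

definition field_adjoin :: "'a::field set \<Rightarrow> 'a \<Rightarrow> 'a set" where
  "field_adjoin K \<theta> = \<Inter>{F. subfield F \<and> K \<subseteq> F \<and> \<theta> \<in> F}"

definition poly_over :: "'a::field set \<Rightarrow> 'a poly \<Rightarrow> bool" where
  "poly_over K g \<longleftrightarrow> (\<forall>i. coeff g i \<in> K)"

definition irreducible_over :: "'a::field set \<Rightarrow> 'a poly \<Rightarrow> bool" where
  "irreducible_over K f \<longleftrightarrow> poly_over K f \<and> degree f \<ge> 1 \<and>
     (\<forall>g h. poly_over K g \<and> poly_over K h \<and> f = g * h \<longrightarrow> degree g = 0 \<or> degree h = 0)"

definition ord_at :: "'a::field set \<Rightarrow> 'a set \<Rightarrow> 'a \<Rightarrow> nat" where
  "ord_at Oc P a = (GREATEST k. a \<in> ideal_pow Oc P k)"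

definition val_at :: "'a::field set \<Rightarrow> 'a set \<Rightarrow> 'a \<Rightarrow> int" where
  "val_at Oc P z = (THE k. \<exists>a\<in>Oc. \<exists>b\<in>Oc. a \<noteq> 0 \<and> b \<noteq> 0 \<and> z = a / b
                        \<and> k = int (ord_at Oc P a) - int (ord_at Oc P b))"

text \<open>Ramification index e_P = v_P(pO) = min of v_P over nonzero elements of p.\<close>
definition ram_index :: "'a::field set \<Rightarrow> 'a set \<Rightarrow> 'a set \<Rightarrow> nat" where
  "ram_index Oc P p = (LEAST k. \<exists>a\<in>p. a \<noteq> 0 \<and> ord_at Oc P a = k)"

definition primes_over :: "'a::field set \<Rightarrow> 'a set \<Rightarrow> 'a set \<Rightarrow> 'a set set" where
  "primes_over A p Oc = {P. prime_ideal_of Oc P \<and> P \<noteq> {0} \<and> P \<inter> A = p}"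

definition wS :: "'a::field set \<Rightarrow> 'a set \<Rightarrow> 'a set \<Rightarrow> 'a \<Rightarrow> ereal" where
  "wS A p Oc z = (if z = 0 then \<infinity> else
     ereal (Min ((\<lambda>P. real_of_int (val_at Oc P z) / real (ram_index Oc P p)) ` primes_over A p Oc)))"

definition efloor :: "ereal \<Rightarrow> ereal" where
  "efloor x = (case x of ereal r \<Rightarrow> ereal (of_int \<lfloor>r\<rfloor>) | PInfty \<Rightarrow> PInfty | MInfty \<Rightarrow> MInfty)"

definition semi_reduced :: "'a::field set \<Rightarrow> 'a set \<Rightarrow> 'a set \<Rightarrow> 'a set \<Rightarrow> nat \<Rightarrow> (nat \<Rightarrow> 'a) \<Rightarrow> bool" where
  "semi_reduced A p Oc K n b \<longleftrightarrow> (\<forall>c. (\<forall>i<n. c i \<in> K) \<longrightarrow>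
     efloor (wS A p Oc (\<Sum>i<n. c i * b i)) = Min ((\<lambda>i. efloor (wS A p Oc (c i * b i))) ` {..<n}))"

definition semi_orthonormal :: "'a::field set \<Rightarrow> 'a set \<Rightarrow> 'a set \<Rightarrow> 'a set \<Rightarrow> nat \<Rightarrow> (nat \<Rightarrow> 'a) \<Rightarrow> bool" where
  "semi_orthonormal A p Oc K n b \<longleftrightarrow> semi_reduced A p Oc K n b \<and>
     (\<forall>i<n. 0 \<le> wS A p Oc (b i) \<and> wS A p Oc (b i) < 1)"

definition is_basis :: "'a::field set \<Rightarrow> 'a set \<Rightarrow> nat \<Rightarrow> (nat \<Rightarrow> 'a) \<Rightarrow> bool" where
  "is_basis R M n b \<longleftrightarrow> (\<forall>i<n. b i \<in> M)
     \<and> (\<forall>c. (\<forall>i<n. c i \<in> R) \<and> (\<Sum>i<n. c i * b i) = 0 \<longrightarrow> (\<forall>i<n. c i = 0))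
     \<and> (\<forall>z\<in>M. \<exists>c. (\<forall>i<n. c i \<in> R) \<and> z = (\<Sum>i<n. c i * b i))"

end

theory Submission
  imports Defs "Jordan_Normal_Form.Char_Poly"
begin

text \<open>
  The valuations \<open>v\<^sub>P\<close> enter only through the equivalence \<open>w\<^sub>S(z) \<ge> 0 \<longleftrightarrow> z \<in> \<O>\<^sub>p\<close> and the rule
  \<open>w\<^sub>S(x z) = v\<^sub>p(x) + w\<^sub>S(z)\<close> for \<open>x \<in> K\<close>. They turn semi-reducedness into the statement that, for
  coefficients in \<open>K\<close>, a sum \<open>\<Sum> c\<^sub>i b\<^sub>i\<close> is integral iff every \<open>c\<^sub>i b\<^sub>i\<close> is, and
  \<open>0 \<le> w\<^sub>S(b) < 1\<close> into \<open>b \<in> \<O>\<^sub>p\<close>, \<open>b / \<pi> \<notin> \<O>\<^sub>p\<close> for a uniformizer \<open>\<pi>\<close> of \<open>A\<^sub>p\<close>.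

  That the \<open>v\<^sub>P\<close> exist needs neither separability of \<open>f\<close> nor finiteness of \<open>\<O>\<close> over \<open>A\<close>: the
  localization \<open>\<O>\<^sub>P\<close> is local and integrally closed in \<open>L\<close> and contains the valuation ring \<open>A\<^sub>p\<close>, hence
  is a valuation ring, and elements whose values differ modulo \<open>v\<^sub>P(K)\<close> are linearly independent
  over \<open>K\<close>, so at most \<open>n\<close> values lie between \<open>0\<close> and \<open>v\<^sub>P(\<pi>)\<close>. The same kind of independence bounds
  the number of primes over \<open>p\<close> by \<open>n\<close>.
\<close>

subsection \<open>Integrality\<close>

text \<open>\<open>ord_at\<close> is a \<open>GREATEST\<close> over powers of \<open>P\<close> and
  \<open>val_at\<close> a \<open>THE\<close>; both mean something only once the powers of
  \<open>P\<close> containing a given nonzero element are bounded. \<open>Oc\<close> is not known in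
  advance to be Noetherian or to factor its ideals. The valuation is therefore built on
  \<open>L\<close> from the localization alone and matched with the powers of \<open>P\<close>
  afterwards, by inverting elements outside \<open>P\<close> modulo each power.

  All finiteness comes from one source: \<open>n + 1\<close> elements of \<open>L\<close> satisfy a
  linear relation over \<open>K\<close>. Dividing it by a coefficient of least value gives
  coefficients in \<open>A_p\<close>, one of them 1, so the relation stays nontrivial when reduced
  modulo a prime over \<open>p\<close>.

  The floor in the definition of semi-reducedness is what makes integrality sufficient: it records
  only integer thresholds, and moving a threshold \<open>k\<close> to 0 is multiplication by
  \<open>\<pi> powi (- k)\<close>, a scalar of \<open>K\<close>. The bound w_S(b) < 1 then says that
  \<open>x b\<close> is integral only for \<open>x\<close> in \<open>A_p\<close>, and linear
  independence follows by scaling a vanishing sum with arbitrary elements of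
  \<open>K\<close>.\<close>

lemma subringD:
  assumes "subring R"
  shows "0 \<in> R" "1 \<in> R" "\<And>x y. x \<in> R \<Longrightarrow> y \<in> R \<Longrightarrow> x + y \<in> R"
    "\<And>x y. x \<in> R \<Longrightarrow> y \<in> R \<Longrightarrow> x - y \<in> R" "\<And>x y. x \<in> R \<Longrightarrow> y \<in> R \<Longrightarrow> x * y \<in> R"
    "\<And>x. x \<in> R \<Longrightarrow> - x \<in> R"
proof -
  show "- x \<in> R" if "x \<in> R" for x
    using assms that unfolding subring_def by (metis diff_0)
qed (use assms in \<open>auto simp: subring_def\<close>)

lemma subring_sum: "subring R \<Longrightarrow> (\<And>i. i \<in> I \<Longrightarrow> g i \<in> R) \<Longrightarrow> sum g I \<in> R"
  by (induction I rule: infinite_finite_induct) (auto simp: subringD)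

lemma subring_prod: "subring R \<Longrightarrow> (\<And>i. i \<in> I \<Longrightarrow> g i \<in> R) \<Longrightarrow> prod g I \<in> R"
  by (induction I rule: infinite_finite_induct) (auto simp: subringD)

lemma subring_power: "subring R \<Longrightarrow> x \<in> R \<Longrightarrow> x ^ k \<in> R"
  by (induction k) (auto simp: subringD)

lemma poly_over_pCons: "poly_over R (pCons a g) \<longleftrightarrow> a \<in> R \<and> poly_over R g"
  unfolding poly_over_def by (auto simp: coeff_pCons split: nat.splits)

lemma poly_over_0: "subring R \<Longrightarrow> poly_over R 0"
  by (simp add: poly_over_def subringD)

lemma poly_over_1: "subring R \<Longrightarrow> poly_over R 1"
  by (simp add: poly_over_def subringD coeff_1)

lemma poly_over_add: "subring R \<Longrightarrow> poly_over R g \<Longrightarrow> poly_over R h \<Longrightarrow> poly_over R (g + h)"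
  by (simp add: poly_over_def subringD)

lemma poly_over_diff: "subring R \<Longrightarrow> poly_over R g \<Longrightarrow> poly_over R h \<Longrightarrow> poly_over R (g - h)"
  by (simp add: poly_over_def subringD)

lemma poly_over_mult: "subring R \<Longrightarrow> poly_over R g \<Longrightarrow> poly_over R h \<Longrightarrow> poly_over R (g * h)"
  by (auto simp: poly_over_def coeff_mult intro!: subring_sum subringD)

lemma poly_over_monom: "subring R \<Longrightarrow> a \<in> R \<Longrightarrow> poly_over R (monom a k)"
  by (simp add: poly_over_def subringD)

lemma poly_over_sum: "subring R \<Longrightarrow> (\<And>i. i \<in> I \<Longrightarrow> poly_over R (g i)) \<Longrightarrow> poly_over R (sum g I)"
  by (induction I rule: infinite_finite_induct) (auto simp: poly_over_0 poly_over_add)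

lemma poly_over_prod: "subring R \<Longrightarrow> (\<And>i. i \<in> I \<Longrightarrow> poly_over R (g i)) \<Longrightarrow> poly_over R (prod g I)"
  by (induction I rule: infinite_finite_induct) (auto simp: poly_over_1 poly_over_mult)

text \<open>The determinant is a signed sum over permutations of products of entries of X I - M, and
  \<open>poly_over R\<close> is preserved by all operations involved.\<close>

lemma poly_over_char_poly:
  assumes R: "subring R" and M: "M \<in> carrier_mat n n"
    and entries: "\<And>i j. i < n \<Longrightarrow> j < n \<Longrightarrow> M $$ (i, j) \<in> R"
  shows "poly_over R (char_poly M)"
proof -
  have ent: "poly_over R (char_poly_matrix M $$ (i, j))" if "i < n" "j < n" for i j
    using that M entries[OF that] R
    by (auto simp: char_poly_matrix_def poly_over_pCons poly_over_0 poly_over_1 subringD)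
  have sg: "poly_over R (of_int (sign \<pi>))" for \<pi> :: "nat \<Rightarrow> nat"
    using poly_over_1[OF R] poly_over_diff[OF R poly_over_0[OF R] poly_over_1[OF R]]
    by (auto simp: sign_def)
  have dim: "dim_row (char_poly_matrix M) = n" "dim_col (char_poly_matrix M) = n"
    using M by (auto simp: char_poly_matrix_def)
  show ?thesis
    unfolding char_poly_def det_def dim
    by (auto intro!: poly_over_sum poly_over_mult poly_over_prod R ent sg
        simp: permutes_in_image)
qed

section \<open>Finitely generated modules and integral elements\<close>

definition mspan :: "'a::field set \<Rightarrow> 'a set \<Rightarrow> 'a set" where
  "mspan R S = {\<Sum>s\<in>S. c s * s | c. \<forall>s\<in>S. c s \<in> R}"

definition submodule :: "'a::field set \<Rightarrow> 'a set \<Rightarrow> bool" where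
  "submodule R M \<longleftrightarrow> 0 \<in> M \<and> (\<forall>x\<in>M. \<forall>y\<in>M. x + y \<in> M) \<and> (\<forall>r\<in>R. \<forall>x\<in>M. r * x \<in> M)"

lemma submodule_sum: "submodule R M \<Longrightarrow> (\<And>i. i \<in> I \<Longrightarrow> g i \<in> M) \<Longrightarrow> sum g I \<in> M"
  by (induction I rule: infinite_finite_induct) (auto simp: submodule_def)

lemma submodule_mspan:
  assumes R: "subring R"
  shows "submodule R (mspan R S)"
  unfolding submodule_def
proof (intro conjI ballI)
  show "0 \<in> mspan R S"
    unfolding mspan_def using subringD[OF R] by (auto intro!: exI[of _ "\<lambda>_. 0"])
  show "x + y \<in> mspan R S" if xy: "x \<in> mspan R S" "y \<in> mspan R S" for x y
  proof -
    obtain c d where "\<forall>s\<in>S. c s \<in> R" "x = (\<Sum>s\<in>S. c s * s)" "\<forall>s\<in>S. d s \<in> R" "y = (\<Sum>s\<in>S. d s * s)"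
      using xy unfolding mspan_def by auto
    then show ?thesis
      unfolding mspan_def using subringD[OF R]
      by (auto intro!: exI[of _ "\<lambda>s. c s + d s"] simp: algebra_simps sum.distrib)
  qed
  show "r * x \<in> mspan R S" if rx: "r \<in> R" "x \<in> mspan R S" for r x
  proof -
    obtain c where "\<forall>s\<in>S. c s \<in> R" "x = (\<Sum>s\<in>S. c s * s)"
      using rx unfolding mspan_def by auto
    then show ?thesis
      unfolding mspan_def using subringD[OF R] rx
      by (auto intro!: exI[of _ "\<lambda>s. r * c s"] simp: algebra_simps sum_distrib_left)
  qed
qed

lemma mspan_base: 
  assumes "subring R" "finite S" "x \<in> S"
  shows "x \<in> mspan R S"
proof -
  have "(\<Sum>s\<in>S. (if s = x then 1 else 0) * s) = x"
    using assms by (simp add: if_distrib[of "\<lambda>u. u * _"] sum.delta cong: if_cong)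
  then show ?thesis
    unfolding mspan_def using subringD[OF assms(1)]
    by (auto intro!: exI[of _ "\<lambda>s. if s = x then 1 else 0"])
qed

lemma mspan_minimal: "submodule R M \<Longrightarrow> S \<subseteq> M \<Longrightarrow> mspan R S \<subseteq> M"
  unfolding mspan_def by (auto intro!: submodule_sum) (auto simp: submodule_def)

text \<open>The characteristic polynomial of multiplication by \<open>x\<close> on a finitely generated module
  is a monic equation for \<open>x\<close>.\<close>

lemma integral_over_if_stable:
  assumes R: "subring R" and S: "finite S" and nz: "s0 \<in> S" "s0 \<noteq> 0"
    and stable: "\<And>s. s \<in> S \<Longrightarrow> x * s \<in> mspan R S"
  shows "integral_over R x"
proof -
  define m where "m = card S"
  obtain h where h: "bij_betw h {0..<m} S"
    using ex_bij_betw_nat_finite[OF S] m_def by auto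
  have "\<exists>c. (\<forall>t\<in>S. c t \<in> R) \<and> x * s = (\<Sum>t\<in>S. c t * t)" if "s \<in> S" for s
    using stable[OF that] unfolding mspan_def by auto
  then obtain c where c: "\<And>s t. s \<in> S \<Longrightarrow> t \<in> S \<Longrightarrow> c s t \<in> R"
    "\<And>s. s \<in> S \<Longrightarrow> x * s = (\<Sum>t\<in>S. c s t * t)"
    by metis
  have hS: "h i \<in> S" if "i < m" for i
    using h that by (auto simp: bij_betw_def)
  define M where "M = mat m m (\<lambda>(i, j). c (h i) (h j))"
  define v where "v = vec m h"
  have M: "M \<in> carrier_mat m m" by (simp add: M_def)
  \<comment> \<open>The relations \<open>x * s = (\<Sum>t\<in>S. c s t * t)\<close> make the vector
    of generators an eigenvector of \<open>M\<close> over the ambient field; one nonzero generator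
    is enough for this vector to be nonzero.\<close>
  have "M *\<^sub>v v = x \<cdot>\<^sub>v v"
  proof (rule eq_vecI)
    fix i assume "i < dim_vec (x \<cdot>\<^sub>v v)"
    then have i: "i < m" by (simp add: v_def)
    have "(M *\<^sub>v v) $ i = (\<Sum>j = 0..<m. c (h i) (h j) * h j)"
      using i by (simp add: M_def v_def scalar_prod_def)
    also have "\<dots> = x * h i"
      using sum.reindex_bij_betw[OF h, of "\<lambda>t. c (h i) t * t"] c(2)[OF hS[OF i]] by simp
    finally show "(M *\<^sub>v v) $ i = (x \<cdot>\<^sub>v v) $ i"
      using i by (simp add: v_def)
  qed (simp_all add: M_def v_def)
  moreover have "v \<noteq> 0\<^sub>v m"
  proof
    assume v0: "v = 0\<^sub>v m"
    obtain i where "i < m" "h i = s0"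
      using nz(1) h by (auto simp: bij_betw_def)
    then show False
      using v0 nz(2) by (metis index_vec index_zero_vec(1) v_def)
  qed
  ultimately have "eigenvalue M x"
    unfolding eigenvalue_def eigenvector_def using M by (auto simp: v_def M_def intro!: exI[of _ v])
  then have "poly (char_poly M) x = 0"
    using eigenvalue_root_char_poly[OF M] by simp
  moreover have "poly_over R (char_poly M)"
    by (rule poly_over_char_poly[OF R M]) (auto simp: M_def c(1) hS)
  moreover have "lead_coeff (char_poly M) = 1"
    using degree_monic_char_poly[OF M] by simp
  ultimately show ?thesis
    unfolding integral_over_def poly_over_def by blast
qed

text \<open>Module-finite ring extensions: unlike a single monic equation, they pass through towers
  and are closed under sums and products by construction.\<close>

definition finite_ext :: "'a::field set \<Rightarrow> 'a set \<Rightarrow> bool" where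
  "finite_ext R B \<longleftrightarrow> subring B \<and> R \<subseteq> B \<and> (\<exists>S. finite S \<and> B = mspan R S)"

lemma finite_ext_refl: "subring R \<Longrightarrow> finite_ext R R"
  unfolding finite_ext_def mspan_def by (auto intro!: exI[of _ "{1}"] exI[of _ "\<lambda>_. _"])

lemma finite_ext_integral:
  assumes R: "subring R" and B: "finite_ext R B" and x: "x \<in> B"
  shows "integral_over R x"
proof -
  obtain S where S: "finite S" "B = mspan R S" using B by (auto simp: finite_ext_def)
  have sub: "subring B" using B by (simp add: finite_ext_def)
  have SB: "S \<subseteq> B" using mspan_base[OF R S(1)] S(2) by auto
  \<comment> \<open>If all generators vanished, \<open>B\<close> would be 0 and could not contain
    1.\<close>
  have "\<exists>s\<in>S. s \<noteq> 0"
  proof (rule ccontr)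
    assume "\<not> ?thesis"
    then have "B \<subseteq> {0}" unfolding S(2) mspan_def by (auto intro!: sum.neutral)
    then show False using subringD(2)[OF sub] by auto
  qed
  then show ?thesis
    using integral_over_if_stable[OF R S(1), of _ x] SB subringD(5)[OF sub x] S(2) by blast
qed

lemma integral_over_mono: "R \<subseteq> R' \<Longrightarrow> integral_over R x \<Longrightarrow> integral_over R' x"
  unfolding integral_over_def by blast

lemma integral_over_base: "subring R \<Longrightarrow> x \<in> R \<Longrightarrow> integral_over R x"
  unfolding integral_over_def
  by (auto intro!: exI[of _ "[:- x, 1:]"] simp: coeff_pCons subringD split: nat.splits)

text \<open>A monic equation of degree \<open>d\<close> makes the powers of \<open>x\<close> below
  \<open>d\<close> span B[x] over \<open>B\<close>, so the products of these powers with the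
  generators of \<open>B\<close> span it over \<open>R\<close>.\<close>

lemma finite_ext_adjoin:
  assumes R: "subring R" and B: "finite_ext R B" and x: "integral_over B x"
  shows "\<exists>B'. finite_ext R B' \<and> B \<subseteq> B' \<and> x \<in> B'"
proof -
  obtain S where S: "finite S" "B = mspan R S" using B by (auto simp: finite_ext_def)
  have sub: "subring B" and RB: "R \<subseteq> B" using B by (auto simp: finite_ext_def)
  obtain g where g: "\<And>i. coeff g i \<in> B" "lead_coeff g = 1" "poly g x = 0"
    using x by (auto simp: integral_over_def)
  define d where "d = degree g"
  define T where "T = (\<lambda>(s, i). s * x ^ i) ` (S \<times> {..<d})"
  have T: "finite T" unfolding T_def using S by auto
  define M where "M = mspan R T"
  have M: "submodule R M" unfolding M_def by (rule submodule_mspan[OF R])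
  have small: "b * x ^ i \<in> M" if "b \<in> B" "i < d" for b i
  proof -
    have "submodule R {b. b * x ^ i \<in> M}"
      using M by (auto simp: submodule_def algebra_simps)
    moreover have "S \<subseteq> {b. b * x ^ i \<in> M}"
      using that(2) by (auto simp: M_def T_def intro!: mspan_base[OF R T[unfolded T_def]])
    ultimately show ?thesis using mspan_minimal[of R _ S] S(2) that(1) by blast
  qed
  have top: "b * x ^ d \<in> M" if "b \<in> B" for b
  proof -
    have "x ^ d = - (\<Sum>i<d. coeff g i * x ^ i)"
      using g(2,3) unfolding poly_altdef d_def by (simp add: lessThan_Suc_atMost[symmetric] add_eq_0_iff)
    then have "b * x ^ d = (\<Sum>i<d. (- b * coeff g i) * x ^ i)"
      by (simp add: sum_distrib_left algebra_simps sum_negf)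
    then show ?thesis
      using g(1) that by (auto intro!: submodule_sum[OF M] small subringD[OF sub] simp del: mult_minus_left)
  qed
  have step: "x * y \<in> M" if "y \<in> M" for y
  proof -
    have "submodule R {y. x * y \<in> M}"
      using M by (auto simp: submodule_def algebra_simps)
    moreover have "T \<subseteq> {y. x * y \<in> M}"
    proof
      fix y assume "y \<in> T"
      then obtain s i where y: "y = s * x ^ i" "s \<in> S" "i < d" by (auto simp: T_def)
      have "s \<in> B" using mspan_base[OF R S(1) y(2)] S(2) by simp
      moreover have "Suc i < d \<or> Suc i = d" using y(3) by auto
      ultimately have "s * x ^ Suc i \<in> M" using small top by metis
      then show "y \<in> {y. x * y \<in> M}" using y(1) by (simp add: algebra_simps)
    qed
    ultimately show ?thesis using mspan_minimal[of R _ T] that M_def by blast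
  qed
  \<comment> \<open>A monic polynomial of degree 0 is the constant 1, which has no root;
    \<open>d > 0\<close> places the power \<open>x ^ 0\<close> among the small ones.\<close>
  have "d > 0"
  proof (rule ccontr)
    assume "\<not> d > 0"
    then have "g = 1" using g(2) d_def by (metis degree_0_id lead_coeff_pCons(2) not_gr0 one_pCons monic_degree_0)
    then show False using g(3) by simp
  qed
  have all: "b * x ^ i \<in> M" if "b \<in> B" for b i
  proof (induction i)
    case 0 then show ?case using small[OF that \<open>d > 0\<close>] by simp
  next
    case (Suc i) then show ?case using step[OF Suc] by (simp add: algebra_simps)
  qed
  \<comment> \<open>B[x] in two guises: \<open>B'\<close> is visibly a ring, \<open>M\<close> is
    visibly finitely generated.\<close>
  define B' where "B' = {poly h x | h. poly_over B h}"
  have "subring B'"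
    unfolding subring_def
  proof (intro conjI ballI)
    show "0 \<in> B'" "1 \<in> B'"
      unfolding B'_def using poly_over_0[OF sub] poly_over_1[OF sub]
      by (force intro: exI[of _ 0], force intro: exI[of _ 1])
  next
    fix u v assume "u \<in> B'" "v \<in> B'"
    then obtain h k where hk: "u = poly h x" "v = poly k x" "poly_over B h" "poly_over B k"
      by (auto simp: B'_def)
    show "u + v \<in> B'" unfolding B'_def hk poly_add[symmetric] using poly_over_add[OF sub] hk by blast
    show "u - v \<in> B'" unfolding B'_def hk poly_diff[symmetric] using poly_over_diff[OF sub] hk by blast
    show "u * v \<in> B'" unfolding B'_def hk poly_mult[symmetric] using poly_over_mult[OF sub] hk by blast
  qed
  moreover have monB: "b * x ^ i \<in> B'" if "b \<in> B" for b i
    unfolding B'_def using poly_over_monom[OF sub that] by (auto intro!: exI[of _ "monom b i"] simp: poly_monom)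
  have BB': "B \<subseteq> B'" using monB[of _ 0] by auto
  moreover have "x \<in> B'" using monB[of 1 1] subringD[OF sub] by simp
  moreover have "B' = M"
  proof
    show "B' \<subseteq> M"
      unfolding B'_def poly_altdef using all by (auto intro!: submodule_sum[OF M] simp: poly_over_def)
    have "submodule R B'"
      using subringD[OF \<open>subring B'\<close>] BB' RB by (auto simp: submodule_def)
    moreover have "T \<subseteq> B'"
      using monB mspan_base[OF R S(1)] S(2) by (auto simp: T_def)
    ultimately show "M \<subseteq> B'" unfolding M_def by (rule mspan_minimal)
  qed
  ultimately show ?thesis
    unfolding finite_ext_def using T M_def RB by blast
qed

lemma finite_ext_adjoin_finite:
  assumes R: "subring R" and "finite X" and "\<And>x. x \<in> X \<Longrightarrow> integral_over R x"
  shows "\<exists>B. finite_ext R B \<and> X \<subseteq> B"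
  using assms(2,3)
proof (induction X rule: finite_induct)
  case empty
  then show ?case using finite_ext_refl[OF R] by auto
next
  case (insert x X)
  then obtain B where B: "finite_ext R B" "X \<subseteq> B" by auto
  have "integral_over B x"
    using integral_over_mono[of R B x] B(1) insert.prems by (auto simp: finite_ext_def)
  then show ?case using finite_ext_adjoin[OF R B(1)] B(2) by blast
qed

text \<open>Two integral elements lie in a common module-finite extension, which contains their sum,
  difference and product.\<close>

lemma subring_integral:
  assumes R: "subring R"
  shows "subring {x. integral_over R x}"
  unfolding subring_def
proof (intro conjI ballI)
  show "0 \<in> {x. integral_over R x}" "1 \<in> {x. integral_over R x}"
    using integral_over_base[OF R] subringD[OF R] by auto
next
  fix x y assume "x \<in> {x. integral_over R x}" "y \<in> {x. integral_over R x}"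
  then obtain B where B: "finite_ext R B" "{x, y} \<subseteq> B"
    using finite_ext_adjoin_finite[OF R, of "{x, y}"] by auto
  then have "x + y \<in> B" "x - y \<in> B" "x * y \<in> B"
    using subringD[of B] by (auto simp: finite_ext_def)
  then show "x + y \<in> {x. integral_over R x}" "x - y \<in> {x. integral_over R x}"
    "x * y \<in> {x. integral_over R x}"
    using finite_ext_integral[OF R B(1)] by auto
qed

text \<open>Only finitely many coefficients occur in the equation of \<open>x\<close>, so they lie
  in one module-finite extension of \<open>R\<close>, and adjoining \<open>x\<close> keeps it
  module-finite.\<close>

lemma integral_over_trans:
  assumes R: "subring R" and C: "\<And>c. c \<in> C \<Longrightarrow> integral_over R c" and x: "integral_over C x"
  shows "integral_over R x"
proof -
  obtain g where g: "\<And>i. coeff g i \<in> C" "lead_coeff g = 1" "poly g x = 0"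
    using x by (auto simp: integral_over_def)
  obtain B where B: "finite_ext R B" "coeff g ` {..degree g} \<subseteq> B"
    using finite_ext_adjoin_finite[OF R, of "coeff g ` {..degree g}"] C g(1) by auto
  have "coeff g i \<in> B" for i
    using B subringD(1)[of B] by (cases "i \<le> degree g") (auto simp: finite_ext_def coeff_eq_0)
  then have "integral_over B x" using g by (auto simp: integral_over_def)
  then show ?thesis
    using finite_ext_adjoin[OF R B(1)] finite_ext_integral[OF R] by blast
qed

section \<open>Clearing denominators in integral equations\<close>

lemma common_denominator:
  assumes R: "subring R" and T: "T \<subseteq> R" "1 \<in> T" "\<And>s t. s \<in> T \<Longrightarrow> t \<in> T \<Longrightarrow> s * t \<in> T" "0 \<notin> T"
    and "finite I" and "\<And>i. i \<in> I \<Longrightarrow> \<exists>s\<in>T. s * z i \<in> R"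
  shows "\<exists>s\<in>T. \<forall>i\<in>I. s * z i \<in> R"
  using assms(6,7)
proof (induction I rule: finite_induct)
  case empty then show ?case using T by auto
next
  case (insert i I)
  then obtain s where "s \<in> T" "\<forall>j\<in>I. s * z j \<in> R" by auto
  moreover obtain t where "t \<in> T" "t * z i \<in> R" using insert.prems by auto
  ultimately have "s * t \<in> T" "\<forall>j\<in>insert i I. (s * t) * z j \<in> R"
    using T(1,3) subringD(5)[OF R, of s "t * z i"] subringD(5)[OF R, of t "s * z _"]
    by (auto simp: algebra_simps)
  then show ?case by blast
qed

text \<open>Scaling the root by \<open>s\<close> multiplies the coefficient of degree
  \<open>i\<close> by \<open>s ^ (d - i)\<close>; below the top degree this contains at least one
  factor \<open>s\<close>, which clears the denominator.\<close>

lemma integral_over_clear_denominators: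
  assumes R: "subring R" and T: "T \<subseteq> R" "1 \<in> T" "\<And>s t. s \<in> T \<Longrightarrow> t \<in> T \<Longrightarrow> s * t \<in> T" "0 \<notin> T"
    and C: "\<And>c. c \<in> C \<Longrightarrow> \<exists>s\<in>T. s * c \<in> R" and x: "integral_over C x"
  shows "\<exists>s\<in>T. integral_over R (s * x)"
proof -
  obtain g where g: "\<And>i. coeff g i \<in> C" "lead_coeff g = 1" "poly g x = 0"
    using x by (auto simp: integral_over_def)
  define d where "d = degree g"
  obtain s where s: "s \<in> T" "\<forall>i\<in>{..<d}. s * coeff g i \<in> R"
    using common_denominator[OF R T, of "{..<d}" "coeff g"] C g(1) by blast
  have sR: "s \<in> R" using s T by auto
  define h where "h = (\<Sum>i\<le>d. monom (s ^ (d - i) * coeff g i) i)"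
  have coeff_h: "coeff h i = (if i \<le> d then s ^ (d - i) * coeff g i else 0)" for i
    unfolding h_def coeff_sum by (simp add: sum.delta)
  have "coeff h i \<in> R" for i
  proof -
    consider "i > d" | "i = d" | "i < d" by linarith
    then show ?thesis
    proof cases
      case 3
      then have "coeff h i = s ^ (d - i - 1) * (s * coeff g i)"
        by (simp add: power_eq_if coeff_h)
      also have "\<dots> \<in> R"
        using s 3 by (intro subringD(5)[OF R subring_power[OF R sR]]) auto
      finally show ?thesis .
    qed (use g(2) subringD[OF R] in \<open>auto simp: coeff_h d_def\<close>)
  qed
  moreover have "degree h = d"
    using g(2) d_def by (intro antisym degree_le le_degree) (auto simp: coeff_h)
  moreover have "coeff h d = 1" using g(2) by (simp add: coeff_h d_def)
  moreover have "poly h (s * x) = 0"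
  proof -
    have "poly h (s * x) = (\<Sum>i\<le>d. s ^ d * (coeff g i * x ^ i))"
      unfolding h_def poly_sum poly_monom
    proof (rule sum.cong)
      fix i assume "i \<in> {..d}"
      then have "s ^ d = s ^ (d - i) * s ^ i" by (simp flip: power_add)
      then show "s ^ (d - i) * coeff g i * (s * x) ^ i = s ^ d * (coeff g i * x ^ i)"
        by (simp add: power_mult_distrib algebra_simps)
    qed simp
    also have "\<dots> = s ^ d * poly g x"
      by (simp add: poly_altdef d_def sum_distrib_left)
    finally show ?thesis using g(3) by simp
  qed
  ultimately show ?thesis
    unfolding integral_over_def using s(1) by (intro bexI[of _ s] exI[of _ h]) auto
qed

subsection \<open>Linear dependence over a subfield\<close>

lemma subfieldD:
  assumes "subfield K"
  shows "subring K" "\<And>x. x \<in> K \<Longrightarrow> inverse x \<in> K" "\<And>x y. x \<in> K \<Longrightarrow> y \<in> K \<Longrightarrow> x / y \<in> K"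
proof -
  show K: "subring K" using assms by (simp add: subfield_def)
  show inv: "inverse x \<in> K" if "x \<in> K" for x
    using assms that by (cases "x = 0") (auto simp: subfield_def)
  show "x / y \<in> K" if "x \<in> K" "y \<in> K" for x y
    using subringD(5)[OF K that(1) inv[OF that(2)]] by (simp add: divide_inverse)
qed

text \<open>A family is used instead of a set so that repeated vectors, such as coinciding powers of
  one element, count as dependent.\<close>

definition lin_dep :: "'a::field set \<Rightarrow> 'i set \<Rightarrow> ('i \<Rightarrow> 'a) \<Rightarrow> bool" where
  "lin_dep K J v \<longleftrightarrow> (\<exists>c. (\<forall>j\<in>J. c j \<in> K) \<and> (\<exists>j\<in>J. c j \<noteq> 0) \<and> (\<Sum>j\<in>J. c j * v j) = 0)"

text \<open>Gaussian elimination: each induction step removes the last spanning vector, at the cost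
  of one member of the family when a pivot is required.\<close>

lemma lin_dep_if_card_greater:
  fixes v :: "'i \<Rightarrow> 'a::field"
  assumes K: "subfield K"
    and "finite J" and "card J > n"
    and "\<And>j. j \<in> J \<Longrightarrow> \<exists>c. (\<forall>i<n. c i \<in> K) \<and> v j = (\<Sum>i<n. c i * w i)"
  shows "lin_dep K J v"
  using assms(2-)
proof (induction n arbitrary: J v)
  case 0
  then obtain j where "j \<in> J" by fastforce
  then show ?case
    using 0 subringD[OF subfieldD(1)[OF K]]
    by (auto simp: lin_dep_def intro!: exI[of _ "\<lambda>_. 1"])
next
  case (Suc n)
  note Kr = subringD[OF subfieldD(1)[OF K]]
  obtain c where c: "\<And>j i. j \<in> J \<Longrightarrow> i < Suc n \<Longrightarrow> c j i \<in> K"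
    "\<And>j. j \<in> J \<Longrightarrow> v j = (\<Sum>i<Suc n. c j i * w i)"
    using Suc.prems(3) by metis
  show ?case
  proof (cases "\<forall>j\<in>J. c j n = 0")
    case True
    then have "\<exists>c. (\<forall>i<n. c i \<in> K) \<and> v j = (\<Sum>i<n. c i * w i)" if "j \<in> J" for j
      using c that by (intro exI[of _ "c j"]) auto
    then show ?thesis using Suc.IH[of J v] Suc.prems(1,2) by auto
  next
    case False
    then obtain k where k: "k \<in> J" "c k n \<noteq> 0" by auto
    \<comment> \<open>Subtracting \<open>q j * v k\<close> cancels the component of
      \<open>v j\<close> along \<open>w n\<close>.\<close>
    define q where "q j = c j n / c k n" for j
    have q: "q j \<in> K" if "j \<in> J" for j
      unfolding q_def using c(1) k that by (intro subfieldD(3)[OF K]) auto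
    define v' where "v' j = v j - q j * v k" for j
    have "\<exists>d. (\<forall>i<n. d i \<in> K) \<and> v' j = (\<Sum>i<n. d i * w i)" if "j \<in> J - {k}" for j
    proof (intro exI conjI allI impI)
      show "c j i - q j * c k i \<in> K" if "i < n" for i
        using that \<open>j \<in> J - {k}\<close> k c(1) q by (auto intro!: Kr)
      have "q j * c k n = c j n" using k by (simp add: q_def)
      then show "v' j = (\<Sum>i<n. (c j i - q j * c k i) * w i)"
        using c(2)[of j] c(2)[of k] that k(1)
        by (simp add: v'_def left_diff_distrib distrib_left sum_subtractf sum_distrib_left flip: mult.assoc)
    qed
    moreover have "card (J - {k}) > n" using Suc.prems k by (simp add: card_Diff_singleton)
    ultimately have "lin_dep K (J - {k}) v'"
      using Suc.IH[of "J - {k}" v'] Suc.prems(1) by auto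
    then obtain d where d: "\<forall>j\<in>J - {k}. d j \<in> K" "\<exists>j\<in>J - {k}. d j \<noteq> 0"
      "(\<Sum>j\<in>J - {k}. d j * v' j) = 0"
      by (auto simp: lin_dep_def)
    \<comment> \<open>The pivot receives the coefficient that collects all subtracted multiples of
      \<open>v k\<close>.\<close>
    define e where "e j = (if j = k then - (\<Sum>j\<in>J - {k}. d j * q j) else d j)" for j
    have "(\<Sum>j\<in>J. e j * v j) = e k * v k + (\<Sum>j\<in>J - {k}. e j * v j)"
      using Suc.prems(1) k(1) by (simp add: sum.remove)
    also have "(\<Sum>j\<in>J - {k}. e j * v j) = (\<Sum>j\<in>J - {k}. d j * v j)"
      by (rule sum.cong) (auto simp: e_def)
    also have "e k * v k + \<dots> = (\<Sum>j\<in>J - {k}. d j * v' j)"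
      by (simp add: e_def v'_def algebra_simps sum_subtractf sum_distrib_left)
    finally have "(\<Sum>j\<in>J. e j * v j) = 0" using d(3) by simp
    moreover have "e j \<in> K" if "j \<in> J" for j
      using that d(1) q by (auto simp: e_def intro!: Kr subring_sum[OF subfieldD(1)[OF K]])
    moreover have "\<exists>j\<in>J. e j \<noteq> 0" using d(2) by (auto simp: e_def)
    ultimately show ?thesis unfolding lin_dep_def by blast
  qed
qed

text \<open>With a nonzero constant term the relation can be solved for \<open>1 / x\<close>;
  otherwise a factor \<open>x\<close> cancels and the relation gets shorter. For
  \<open>x = 0\<close> the convention \<open>inverse 0 = 0\<close> applies.\<close>

lemma algebraic_inverse:
  fixes x :: "'a::field" and c :: "nat \<Rightarrow> 'a"
  assumes K: "subfield K" and M: "subring M" "K \<subseteq> M" "x \<in> M"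
    and c: "\<And>i. i \<le> n \<Longrightarrow> c i \<in> K" "(\<Sum>i\<le>n. c i * x ^ i) = 0" "\<exists>i\<le>n. c i \<noteq> 0"
  shows "inverse x \<in> M"
  using c
proof (induction n arbitrary: c)
  case 0
  then show ?case by auto
next
  case (Suc n)
  have eq: "c 0 + x * (\<Sum>i\<le>n. c (Suc i) * x ^ i) = 0"
    using Suc.prems(2) unfolding sum.atMost_Suc_shift by (simp add: sum_distrib_left algebra_simps)
  show ?case
  proof (cases "x = 0")
    case True
    then show ?thesis using subringD(1)[OF M(1)] by simp
  next
    case x: False
    show ?thesis
    proof (cases "c 0 = 0")
      case True
      then have "(\<Sum>i\<le>n. c (Suc i) * x ^ i) = 0" using eq x by simp
      moreover have "\<exists>i\<le>n. c (Suc i) \<noteq> 0"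
        using Suc.prems(3) True by (metis Suc_le_mono not0_implies_Suc)
      ultimately show ?thesis using Suc.IH[of "\<lambda>i. c (Suc i)"] Suc.prems(1) by auto
    next
      case False
      have "inverse x = - (inverse (c 0) * (\<Sum>i\<le>n. c (Suc i) * x ^ i))"
        using eq x False by (simp add: field_simps add_eq_0_iff2)
      moreover have "inverse (c 0) \<in> M" using Suc.prems(1)[of 0] subfieldD(2)[OF K] M(2) by auto
      moreover have "(\<Sum>i\<le>n. c (Suc i) * x ^ i) \<in> M"
        using Suc.prems(1) M
        by (intro subring_sum[OF M(1)] subringD(5)[OF M(1)] subring_power[OF M(1)]) auto
      ultimately show ?thesis using subringD[OF M(1)] by simp
    qed
  qed
qed

text \<open>The polynomial expressions in \<open>\<theta>\<close> form a ring \<open>F\<close>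
  inside the span \<open>W\<close> of the first \<open>n\<close> powers. Each element of
  \<open>F\<close> is thus algebraic over \<open>K\<close>, which gives inverses, so
  \<open>F\<close> is a field and contains \<open>field_adjoin K \<theta>\<close>.\<close>

lemma field_adjoin_span:
  assumes K: "subfield K" and f: "poly_over K f" "lead_coeff f = 1" "degree f \<ge> 1" "poly f \<theta> = 0"
    and z: "z \<in> field_adjoin K \<theta>"
  shows "\<exists>c. (\<forall>i<degree f. c i \<in> K) \<and> z = (\<Sum>i<degree f. c i * \<theta> ^ i)"
proof -
  define n where "n = degree f"
  have Kr: "subring K" using subfieldD(1)[OF K] .
  define F where "F = {poly h \<theta> | h. poly_over K h}"
  define W where "W = {\<Sum>i<n. c i * \<theta> ^ i | c. \<forall>i<n. c i \<in> K}"
  have WI: "(\<Sum>i<n. c i * \<theta> ^ i) \<in> W" if "\<And>i. i < n \<Longrightarrow> c i \<in> K" for c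
    using that unfolding W_def by auto
  have W: "submodule K W"
    unfolding submodule_def
  proof (intro conjI ballI)
    show "0 \<in> W" using WI[of "\<lambda>_. 0"] subringD[OF Kr] by simp
  next
    fix x y assume "x \<in> W" "y \<in> W"
    then obtain c d where "\<forall>i<n. c i \<in> K" "x = (\<Sum>i<n. c i * \<theta> ^ i)" "\<forall>i<n. d i \<in> K" "y = (\<Sum>i<n. d i * \<theta> ^ i)"
      unfolding W_def by auto
    then show "x + y \<in> W"
      using WI[of "\<lambda>i. c i + d i"] subringD[OF Kr] by (simp add: algebra_simps sum.distrib)
  next
    fix r x assume "r \<in> K" "x \<in> W"
    moreover then obtain c where "\<forall>i<n. c i \<in> K" "x = (\<Sum>i<n. c i * \<theta> ^ i)"
      unfolding W_def by auto
    ultimately show "r * x \<in> W"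
      using WI[of "\<lambda>i. r * c i"] subringD[OF Kr] by (simp add: algebra_simps sum_distrib_left)
  qed
  have small: "\<theta> ^ i \<in> W" if "i < n" for i
  proof -
    have "(\<Sum>j<n. (if j = i then 1 else 0) * \<theta> ^ j) = \<theta> ^ i"
      using that by (simp add: if_distrib[of "\<lambda>u. u * _"] cong: if_cong)
    then show ?thesis using WI[of "\<lambda>j. if j = i then 1 else 0"] subringD[OF Kr] by auto
  qed
  have "\<theta> ^ n = (\<Sum>i<n. - coeff f i * \<theta> ^ i)"
    using f(2,4) unfolding poly_altdef n_def
    by (simp add: lessThan_Suc_atMost[symmetric] add_eq_0_iff sum_negf)
  then have top: "\<theta> ^ n \<in> W"
    using WI[of "\<lambda>i. - coeff f i"] f(1) subringD[OF Kr] by (simp add: poly_over_def)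
  have mult: "\<theta> * y \<in> W" if y: "y \<in> W" for y
  proof -
    obtain c where c: "\<forall>i<n. c i \<in> K" "y = (\<Sum>i<n. c i * \<theta> ^ i)"
      using y unfolding W_def by auto
    have "\<theta> * y = (\<Sum>i<n. c i * \<theta> ^ Suc i)"
      unfolding c by (simp add: sum_distrib_left algebra_simps)
    also have "\<dots> \<in> W"
    proof (rule submodule_sum[OF W])
      fix i assume i: "i \<in> {..<n}"
      then have "Suc i < n \<or> Suc i = n" by auto
      then have "\<theta> ^ Suc i \<in> W" using small top by metis
      then show "c i * \<theta> ^ Suc i \<in> W" using W c(1) i unfolding submodule_def by blast
    qed
    finally show ?thesis .
  qed
  have pow: "\<theta> ^ i \<in> W" for i
  proof (induction i)
    case 0
    then show ?case using small[of 0] f(3) n_def by simp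
  qed (simp add: mult)
  have FW: "F \<subseteq> W"
    unfolding F_def poly_altdef using W pow
    by (auto intro!: submodule_sum[OF W] simp: poly_over_def submodule_def)
  have sub: "subring F"
    unfolding subring_def
  proof (intro conjI ballI)
    show "0 \<in> F" "1 \<in> F"
      unfolding F_def using poly_over_0[OF Kr] poly_over_1[OF Kr]
      by (force intro: exI[of _ 0], force intro: exI[of _ 1])
  next
    fix u v assume "u \<in> F" "v \<in> F"
    then obtain h k where hk: "u = poly h \<theta>" "v = poly k \<theta>" "poly_over K h" "poly_over K k"
      by (auto simp: F_def)
    show "u + v \<in> F" unfolding F_def hk poly_add[symmetric] using poly_over_add[OF Kr] hk by blast
    show "u - v \<in> F" unfolding F_def hk poly_diff[symmetric] using poly_over_diff[OF Kr] hk by blast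
    show "u * v \<in> F" unfolding F_def hk poly_mult[symmetric] using poly_over_mult[OF Kr] hk by blast
  qed
  have mon: "a * \<theta> ^ i \<in> F" if "a \<in> K" for a i
    unfolding F_def using poly_over_monom[OF Kr that] by (auto intro!: exI[of _ "monom a i"] simp: poly_monom)
  have KF: "K \<subseteq> F" using mon[of _ 0] by auto
  have "\<theta> \<in> F" using mon[of 1 1] subringD[OF Kr] by simp
  moreover have "inverse x \<in> F" if x: "x \<in> F" for x
  proof -
    \<comment> \<open>These are \<open>n + 1\<close> powers of \<open>x\<close> in a space spanned
      by \<open>n\<close> vectors.\<close>
    have "lin_dep K {..n} (\<lambda>i. x ^ i)"
    proof (rule lin_dep_if_card_greater[OF K, of _ n _ "\<lambda>i. \<theta> ^ i"])
      fix j
      have "x ^ j \<in> W" using subring_power[OF sub x] FW by auto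
      then show "\<exists>c. (\<forall>i<n. c i \<in> K) \<and> x ^ j = (\<Sum>i<n. c i * \<theta> ^ i)" by (auto simp: W_def)
    qed auto
    then obtain c where "\<forall>i\<in>{..n}. c i \<in> K" "\<exists>i\<in>{..n}. c i \<noteq> 0" "(\<Sum>i\<le>n. c i * x ^ i) = 0"
      unfolding lin_dep_def by auto
    then show ?thesis by (intro algebraic_inverse[OF K sub KF x, of n c]) auto
  qed
  ultimately have "field_adjoin K \<theta> \<subseteq> F"
    unfolding field_adjoin_def subfield_def using sub KF by auto
  then show ?thesis using z FW unfolding W_def n_def by auto
qed

lemma field_adjoin_lin_dep:
  assumes K: "subfield K" and f: "poly_over K f" "lead_coeff f = 1" "degree f \<ge> 1" "poly f \<theta> = 0"
    and J: "finite J" "card J > degree f" "\<And>j. j \<in> J \<Longrightarrow> v j \<in> field_adjoin K \<theta>"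
  shows "lin_dep K J v"
  using lin_dep_if_card_greater[OF K J(1,2)] field_adjoin_span[OF K f] J(3) by blast

lemma subfield_field_adjoin: "subfield (field_adjoin K \<theta>)"
  and subset_field_adjoin: "K \<subseteq> field_adjoin K \<theta>"
proof -
  show "subfield (field_adjoin K \<theta>)"
    unfolding field_adjoin_def subfield_def subring_def by auto
qed (auto simp: field_adjoin_def)

subsection \<open>Ideals and localization\<close>

lemma ideal_ofD:
  assumes "ideal_of R I"
  shows "I \<subseteq> R" "0 \<in> I" "\<And>x y. x \<in> I \<Longrightarrow> y \<in> I \<Longrightarrow> x + y \<in> I" "\<And>x. x \<in> I \<Longrightarrow> - x \<in> I"
    "\<And>x y. x \<in> I \<Longrightarrow> y \<in> I \<Longrightarrow> x - y \<in> I"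
    "\<And>r x. r \<in> R \<Longrightarrow> x \<in> I \<Longrightarrow> r * x \<in> I" "\<And>r x. r \<in> R \<Longrightarrow> x \<in> I \<Longrightarrow> x * r \<in> I"
proof -
  show "x - y \<in> I" if "x \<in> I" "y \<in> I" for x y
    using assms that unfolding ideal_of_def diff_conv_add_uminus by blast
  show "x * r \<in> I" if "r \<in> R" "x \<in> I" for r x
    using assms that unfolding ideal_of_def by (subst mult.commute) blast
qed (use assms in \<open>auto simp: ideal_of_def\<close>)

lemma ideal_of_self: "subring R \<Longrightarrow> ideal_of R R"
  by (simp add: ideal_of_def subringD)

lemma ideal_ofI:
  assumes "subring R" "I \<subseteq> R" "0 \<in> I" "\<And>x y. x \<in> I \<Longrightarrow> y \<in> I \<Longrightarrow> x + y \<in> I"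
    "\<And>r x. r \<in> R \<Longrightarrow> x \<in> I \<Longrightarrow> r * x \<in> I"
  shows "ideal_of R I"
proof -
  have "- x \<in> I" if "x \<in> I" for x
    using assms(5)[of "- 1" x] subringD[OF assms(1)] that by simp
  then show ?thesis using assms by (auto simp: ideal_of_def)
qed

lemma ideal_gen_minimal: "ideal_of R I \<Longrightarrow> X \<subseteq> I \<Longrightarrow> ideal_gen R X \<subseteq> I"
  by (auto simp: ideal_gen_def)

lemma ideal_gen_base: "X \<subseteq> ideal_gen R X"
  by (auto simp: ideal_gen_def)

lemma ideal_of_ideal_gen:
  assumes R: "subring R" and "X \<subseteq> R"
  shows "ideal_of R (ideal_gen R X)"
proof (rule ideal_ofI[OF R])
  show "ideal_gen R X \<subseteq> R" using ideal_gen_minimal[OF ideal_of_self[OF R] assms(2)] .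
qed (auto simp: ideal_gen_def intro: ideal_ofD)

lemma ideal_of_one: "ideal_of R I \<Longrightarrow> 1 \<in> I \<Longrightarrow> I = R"
  using ideal_ofD(1)[of R I] ideal_ofD(6)[of R I _ 1] by auto

lemma ideal_plus_principal:
  assumes R: "subring R" and I: "ideal_of R I" and x: "x \<in> R"
  shows "ideal_of R {i + r * x | i r. i \<in> I \<and> r \<in> R}" (is "ideal_of R ?J")
    and "I \<subseteq> {i + r * x | i r. i \<in> I \<and> r \<in> R}"
    and "x \<in> {i + r * x | i r. i \<in> I \<and> r \<in> R}"
proof -
  note Ir = ideal_ofD[OF I] and Rr = subringD[OF R]
  show sub: "I \<subseteq> ?J" using Rr(1) by force
  show "x \<in> ?J" using Ir(2) Rr(2) by force
  show "ideal_of R ?J"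
  proof (rule ideal_ofI[OF R])
    show "?J \<subseteq> R" using Ir(1) Rr(3,5) x by blast
    show "0 \<in> ?J" using sub Ir(2) by blast
    show "a + b \<in> ?J" if ab: "a \<in> ?J" "b \<in> ?J" for a b
    proof -
      obtain i r j s where "a = i + r * x" "b = j + s * x" "i \<in> I" "j \<in> I" "r \<in> R" "s \<in> R"
        using ab by blast
      moreover from this have "a + b = (i + j) + (r + s) * x" by (simp add: algebra_simps)
      ultimately show ?thesis using Ir(3) Rr(3) by blast
    qed
    show "s * a \<in> ?J" if sa: "s \<in> R" "a \<in> ?J" for s a
    proof -
      obtain i r where "a = i + r * x" "i \<in> I" "r \<in> R" using sa(2) by blast
      moreover from this have "s * a = s * i + (s * r) * x" by (simp add: algebra_simps)
      ultimately show ?thesis using Ir(6)[OF sa(1)] Rr(5)[OF sa(1)] by blast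
    qed
  qed
qed

lemma prime_ideal_ofD:
  assumes "prime_ideal_of R P"
  shows "ideal_of R P" "P \<subseteq> R" "1 \<notin> P"
    "\<And>a b. a \<in> R \<Longrightarrow> b \<in> R \<Longrightarrow> a * b \<in> P \<Longrightarrow> a \<in> P \<or> b \<in> P"
  using assms ideal_of_one[of R P] unfolding prime_ideal_of_def by (auto dest: ideal_ofD(1))

section \<open>Chains of ideals and maximal elements\<close>

lemma ideal_of_Union_chain:
  assumes R: "subring R" and C: "C \<noteq> {}" "subset.chain \<I> C" "\<And>I. I \<in> \<I> \<Longrightarrow> ideal_of R I"
  shows "ideal_of R (\<Union>C)"
proof -
  have CI: "ideal_of R I" if "I \<in> C" for I using C(2,3) that by (auto simp: subset.chain_def)
  show ?thesis
  proof (rule ideal_ofI[OF R])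
    show "\<Union>C \<subseteq> R" "0 \<in> \<Union>C" using C(1) ideal_ofD(1,2)[OF CI] by blast+
    show "r * x \<in> \<Union>C" if "r \<in> R" "x \<in> \<Union>C" for r x using that ideal_ofD(6)[OF CI] by blast
    fix x y assume "x \<in> \<Union>C" "y \<in> \<Union>C"
    then obtain I J where IJ: "I \<in> C" "J \<in> C" "x \<in> I" "y \<in> J" by auto
    then have "I \<subseteq> J \<or> J \<subseteq> I" using C(2) by (auto simp: subset.chain_def)
    then show "x + y \<in> \<Union>C" using IJ ideal_ofD(3)[OF CI] by blast
  qed
qed

text \<open>The union of a chain is finitely generated, and the member of the chain that contains
  the generators is already the whole union, so Zorn's lemma applies to any nonempty family.\<close>

lemma noetherian_maximal_element:
  assumes R: "subring R" and noeth: "\<And>I. ideal_of R I \<Longrightarrow> \<exists>F. finite F \<and> F \<subseteq> I \<and> I = ideal_gen R F"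
    and ne: "\<I> \<noteq> {}" and ideals: "\<And>I. I \<in> \<I> \<Longrightarrow> ideal_of R I"
  shows "\<exists>M\<in>\<I>. \<forall>I\<in>\<I>. M \<subseteq> I \<longrightarrow> I = M"
proof (rule subset_Zorn_nonempty[OF ne])
  fix C assume C: "C \<noteq> {}" "subset.chain \<I> C"
  obtain F where F: "finite F" "F \<subseteq> \<Union>C" "\<Union>C = ideal_gen R F"
    using noeth[OF ideal_of_Union_chain[OF R C ideals]] by auto
  obtain I where I: "I \<in> C" "F \<subseteq> I"
    using finite_subset_Union_chain[OF F(1,2) C] by blast
  have "I \<in> \<I>" using I(1) C(2) by (auto simp: subset.chain_def)
  moreover have "\<Union>C \<subseteq> I" using F(3) ideal_gen_minimal[OF ideals[OF \<open>I \<in> \<I>\<close>] I(2)] by simp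
  ultimately show "\<Union>C \<in> \<I>" using I(1) by (metis Union_upper subset_antisym)
qed

section \<open>Localization at a prime ideal\<close>

context
  fixes A p :: "'a::field set"
  assumes A: "subring A" and p: "prime_ideal_of A p"
begin

lemma localizationI: "a \<in> A \<Longrightarrow> s \<in> A \<Longrightarrow> s \<notin> p \<Longrightarrow> a / s \<in> localization A p"
  unfolding localization_def by auto

lemma not_in_prime_nonzero: "s \<notin> p \<Longrightarrow> s \<noteq> 0"
  using ideal_ofD(2)[OF prime_ideal_ofD(1)[OF p]] by auto

lemma subset_localization: "A \<subseteq> localization A p"
proof
  fix x assume "x \<in> A"
  then have "x / 1 \<in> localization A p"
    using prime_ideal_ofD(3)[OF p] subringD(2)[OF A] by (intro localizationI)
  then show "x \<in> localization A p" by simp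
qed

lemma localization_inverse: "s \<in> A \<Longrightarrow> s \<notin> p \<Longrightarrow> inverse s \<in> localization A p"
  using localizationI[of 1 s] subringD[OF A] by (simp add: inverse_eq_divide)

lemma mult_not_in_prime: "s \<in> A \<Longrightarrow> s \<notin> p \<Longrightarrow> t \<in> A \<Longrightarrow> t \<notin> p \<Longrightarrow> s * t \<notin> p"
  using prime_ideal_ofD(4)[OF p] by blast

lemma subring_localization: "subring (localization A p)"
  unfolding subring_def
proof (intro conjI ballI)
  show "0 \<in> localization A p" "1 \<in> localization A p"
    using subset_localization subringD[OF A] by auto
next
  fix x y assume "x \<in> localization A p" "y \<in> localization A p"
  then obtain a s b t where xy: "x = a / s" "y = b / t" and mem: "a \<in> A" "b \<in> A" "s \<in> A" "t \<in> A" "s \<notin> p" "t \<notin> p"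
    unfolding localization_def by auto
  have st: "s \<noteq> 0" "t \<noteq> 0" using mem not_in_prime_nonzero by auto
  have "x + y = (a * t + b * s) / (s * t)" "x - y = (a * t - b * s) / (s * t)" "x * y = (a * b) / (s * t)"
    using st by (auto simp: xy field_simps)
  then show "x + y \<in> localization A p" "x - y \<in> localization A p" "x * y \<in> localization A p"
    using mem mult_not_in_prime subringD[OF A] by (auto intro!: localizationI)
qed

lemma localization_nonunit:
  assumes "x \<in> localization A p" "inverse x \<notin> localization A p"
  shows "\<exists>a\<in>p. \<exists>s\<in>A - p. x = a / s"
proof -
  obtain a s where as: "a \<in> A" "s \<in> A" "s \<notin> p" "x = a / s" using assms(1) unfolding localization_def by auto
  then have "a \<in> p" using assms(2) localizationI[of s a] by auto
  then show ?thesis using as by auto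
qed

lemma inverse_prime_not_in_localization:
  assumes "a \<in> p" "a \<noteq> 0"
  shows "inverse a \<notin> localization A p"
proof
  assume "inverse a \<in> localization A p"
  then obtain b s where bs: "b \<in> A" "s \<in> A" "s \<notin> p" "inverse a = b / s" unfolding localization_def by auto
  then have "s = b * a" using assms(2) not_in_prime_nonzero[of s] by (auto simp: field_simps)
  then show False using bs assms(1) ideal_ofD(6)[OF prime_ideal_ofD(1)[OF p]] by simp
qed

lemma localization_clear:
  assumes "c \<in> localization A p"
  shows "\<exists>s\<in>A - p. s * c \<in> A"
proof -
  obtain a s where "a \<in> A" "s \<in> A" "s \<notin> p" "c = a / s" using assms unfolding localization_def by auto
  then show ?thesis using not_in_prime_nonzero[of s] by (intro bexI[of _ s]) auto
qed

lemma localization_unclear: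
  assumes "s \<in> A - p" "s * c \<in> A"
  shows "c \<in> localization A p"
  using localizationI[of "s * c" s] assms not_in_prime_nonzero[of s] by simp

lemma integral_over_localization:
  assumes "integral_over (localization A p) x"
  shows "\<exists>s\<in>A - p. integral_over A (s * x)"
proof (rule integral_over_clear_denominators[OF A _ _ _ _ _ assms])
  show "1 \<in> A - p" using subringD(2)[OF A] prime_ideal_ofD(3)[OF p] by simp
  show "s * t \<in> A - p" if "s \<in> A - p" "t \<in> A - p" for s t
    using that mult_not_in_prime[of s t] subringD(5)[OF A, of s t] by simp
  show "0 \<notin> A - p" using not_in_prime_nonzero by auto
  show "\<exists>s\<in>A - p. s * c \<in> A" if "c \<in> localization A p" for c using localization_clear[OF that] .
qed simp

end

lemma prime_ideal_of_zero: "subring R \<Longrightarrow> prime_ideal_of R {0}"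
  unfolding prime_ideal_of_def ideal_of_def by (auto simp: subringD dest: subringD(2))

text \<open>This makes the lemmas on localizations, in particular the clearing of denominators,
  available for the fraction field.\<close>

lemma frac_field_eq_localization: "frac_field A = localization A {0}"
  by (auto simp: frac_field_def localization_def)

lemma subfield_frac_field:
  assumes A: "subring A"
  shows "subfield (frac_field A)"
proof -
  have "subring (frac_field A)"
    unfolding frac_field_eq_localization by (rule subring_localization[OF A prime_ideal_of_zero[OF A]])
  moreover have "inverse x \<in> frac_field A" if "x \<in> frac_field A" "x \<noteq> 0" for x
    using that unfolding frac_field_def by force
  ultimately show ?thesis by (simp add: subfield_def)
qed

lemma subset_frac_field: "subring A \<Longrightarrow> A \<subseteq> frac_field A"
  unfolding frac_field_eq_localization by (rule subset_localization[OF _ prime_ideal_of_zero])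

lemma localization_subset_frac_field:
  assumes "subring A" "prime_ideal_of A p"
  shows "localization A p \<subseteq> frac_field A"
  using not_in_prime_nonzero[OF assms] unfolding localization_def frac_field_def by blast

subsection \<open>Discrete valuations\<close>

text \<open>The ultrametric inequality is encoded by the second clause: when \<open>R\<close> is a
  ring, \<open>v x \<ge> v y\<close> gives \<open>1 + x / y \<in> R\<close>. The third clause
  normalizes the value group to all integers.\<close>

definition dvaluation :: "'a::field set \<Rightarrow> 'a set \<Rightarrow> ('a \<Rightarrow> int) \<Rightarrow> bool" where
  "dvaluation F R v \<longleftrightarrow> (\<forall>x\<in>F - {0}. \<forall>y\<in>F - {0}. v (x * y) = v x + v y) \<and>
     (\<forall>x\<in>F - {0}. 0 \<le> v x \<longleftrightarrow> x \<in> R) \<and> (\<exists>t\<in>F - {0}. v t = 1)"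

text \<open>Divide by \<open>t\<close> as long as the quotient stays in \<open>R\<close>; by
  \<open>sep\<close> this stops, and by \<open>nonunit\<close> the last quotient is a unit. So every
  nonzero element of \<open>F\<close> is a unit times a unique power of \<open>t\<close>, whose
  exponent is the value.\<close>

lemma dvaluation_exists:
  assumes F: "subfield F" and R: "subring R" "R \<subseteq> F"
    and t: "t \<in> R" "t \<noteq> 0" "inverse t \<notin> R"
    and nonunit: "\<And>x. x \<in> R \<Longrightarrow> inverse x \<notin> R \<Longrightarrow> x / t \<in> R"
    and sep: "\<And>x. x \<in> R \<Longrightarrow> x \<noteq> 0 \<Longrightarrow> \<exists>k. x / t ^ k \<notin> R"
    and frac: "\<And>z. z \<in> F \<Longrightarrow> \<exists>a\<in>R. \<exists>b\<in>R. b \<noteq> 0 \<and> z = a / b"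
  shows "\<exists>v. dvaluation F R v \<and> v t = 1"
proof -
  note Rr = subringD[OF R(1)]
  define U where "U = {x \<in> R. x \<noteq> 0 \<and> inverse x \<in> R}"
  have U: "x * y \<in> U" "x / y \<in> U" if "x \<in> U" "y \<in> U" for x y
    using that Rr(5) by (auto simp: U_def divide_inverse)
  have one: "1 \<in> U" using Rr by (auto simp: U_def)
  \<comment> \<open>A unit divisible by \<open>t\<close> would make \<open>t\<close> itself a unit;
    this yields the uniqueness of the exponent.\<close>
  have no_unit: "x * t ^ Suc m \<notin> U" if "x \<in> R" for x m
  proof
    assume "x * t ^ Suc m \<in> U"
    then have inv: "inverse (x * t ^ Suc m) \<in> R" and "x \<noteq> 0"
      by (auto simp: U_def simp del: power_Suc)
    have "x * t ^ m * inverse (x * t ^ Suc m) \<in> R"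
      by (intro Rr(5) subring_power[OF R(1)] that t inv)
    then show False using t \<open>x \<noteq> 0\<close> by (simp add: field_simps)
  qed
  have exR: "\<exists>k. x / t ^ k \<in> U" if x: "x \<in> R" "x \<noteq> 0" for x
  proof -
    define m where "m = (LEAST m. x / t ^ m \<notin> R)"
    have m: "x / t ^ m \<notin> R" unfolding m_def using sep[OF x] by (rule LeastI_ex)
    then obtain k where k: "m = Suc k" using x by (cases m) auto
    have "x / t ^ k \<in> R" using not_less_Least[of k "\<lambda>m. x / t ^ m \<notin> R"] k m_def by auto
    moreover have "inverse (x / t ^ k) \<in> R"
    proof (rule ccontr)
      assume "inverse (x / t ^ k) \<notin> R"
      with nonunit[OF \<open>x / t ^ k \<in> R\<close>] have "x / t ^ k / t \<in> R" .
      then show False using m k by (simp add: mult.commute)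
    qed
    ultimately show ?thesis using x t by (auto simp: U_def)
  qed
  have ex: "\<exists>k. z / t powi k \<in> U" if z: "z \<in> F - {0}" for z
  proof -
    obtain a b where ab: "a \<in> R" "b \<in> R" "b \<noteq> 0" "z = a / b" using frac z by blast
    then obtain k l where "a / t ^ k \<in> U" "b / t ^ l \<in> U" using exR[of a] exR[of b] z by auto
    then have "(a / t ^ k) / (b / t ^ l) \<in> U" by (rule U)
    also have "(a / t ^ k) / (b / t ^ l) = z / t powi (int k - int l)"
      using ab t by (simp add: power_int_diff)
    finally show ?thesis by blast
  qed
  have uniq_le: "\<not> k < l" if "z / t powi k \<in> U" "z / t powi l \<in> U" for z k l
  proof
    assume "k < l"
    then obtain m where m: "l = k + int (Suc m)" using zless_iff_Suc_zadd by auto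
    have "(z / t powi k) / (z / t powi l) \<in> U" using that by (rule U)
    also have "(z / t powi k) / (z / t powi l) = 1 * t ^ Suc m"
    proof -
      have "t powi l = t powi k * t ^ Suc m"
        unfolding m using t(2) by (simp only: power_int_add power_int_of_nat simp_thms)
      moreover have "z \<noteq> 0" using that(1) by (auto simp: U_def)
      ultimately show ?thesis using t(2) by (simp del: power_Suc)
    qed
    finally show False using no_unit[OF Rr(2)] by blast
  qed
  define v where "v z = (THE k. z / t powi k \<in> U)" for z
  have vI: "v z = k" if "z / t powi k \<in> U" for z k
    unfolding v_def
  proof (rule the_equality)
    show "l = k" if "z / t powi l \<in> U" for l
      using uniq_le[OF that \<open>z / t powi k \<in> U\<close>] uniq_le[OF \<open>z / t powi k \<in> U\<close> that] by simp
  qed (rule that)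
  have v: "z / t powi v z \<in> U" if "z \<in> F - {0}" for z
    using ex[OF that] vI by blast
  have "v (x * y) = v x + v y" if "x \<in> F - {0}" "y \<in> F - {0}" for x y
    using U(1)[OF v[OF that(1)] v[OF that(2)]] t by (intro vI) (simp add: power_int_add)
  moreover have "0 \<le> v x \<longleftrightarrow> x \<in> R" if x: "x \<in> F - {0}" for x
  proof
    assume "0 \<le> v x"
    then obtain k where k: "v x = int k" using zero_le_imp_eq_int by blast
    then have "x / t ^ k \<in> R" using v[OF x] by (simp add: U_def)
    then have "x / t ^ k * t ^ k \<in> R" by (rule Rr(5)[OF _ subring_power[OF R(1) t(1)]])
    then show "x \<in> R" using t by simp
  next
    assume xR: "x \<in> R"
    show "0 \<le> v x"
    proof (rule ccontr)
      assume "\<not> 0 \<le> v x"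
      then obtain m where "v x = - int (Suc m)" using negD[of "v x"] by auto
      then have "x / t powi v x = x * t ^ Suc m"
        by (simp only: power_int_minus power_int_of_nat divide_inverse inverse_inverse_eq)
      then show False using v[OF x] no_unit[OF xR, of m] by simp
    qed
  qed
  moreover have "v t = 1" using one t by (intro vI) simp
  ultimately show ?thesis unfolding dvaluation_def using t R(2) by blast
qed

lemma dedekind_localization_integrally_closed:
  assumes D: "dedekind_domain A" and p: "prime_ideal_of A p"
    and x: "x \<in> frac_field A" "integral_over (localization A p) x"
  shows "x \<in> localization A p"
proof -
  have A: "subring A" using D by (simp add: dedekind_domain_def)
  obtain s where s: "s \<in> A - p" "integral_over A (s * x)"
    using integral_over_localization[OF A p x(2)] by auto
  have "s * x \<in> frac_field A"
    using subringD(5)[OF subfieldD(1)[OF subfield_frac_field[OF A]]] subset_frac_field[OF A] s x by auto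
  then have "s * x \<in> A" using D s by (auto simp: dedekind_domain_def)
  then show ?thesis using localization_unclear[OF A p s(1)] by simp
qed

text \<open>An ideal maximal among the conductors \<open>{r \<in> A. r w \<in> A\<^sub>p}\<close> with \<open>w \<notin> A\<^sub>p\<close> is prime, hence equal to \<open>p\<close>.
  Since \<open>w\<close> is not integral, \<open>w p\<close> contains a unit \<open>w q\<close>, and \<open>q\<close> generates \<open>p A\<^sub>p\<close>.\<close>

lemma dedekind_localization_dvaluation:
  assumes D: "dedekind_domain A" and p: "prime_ideal_of A p" "p \<noteq> {0}"
  shows "\<exists>v. dvaluation (frac_field A) (localization A p) v \<and> (\<exists>t\<in>p. t \<noteq> 0 \<and> v t = 1)"
proof -
  have A: "subring A" and noeth: "\<And>I. ideal_of A I \<Longrightarrow> \<exists>F. finite F \<and> F \<subseteq> I \<and> I = ideal_gen A F"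
    and dim1: "\<And>P. prime_ideal_of A P \<Longrightarrow> P \<noteq> {0} \<Longrightarrow> maximal_ideal_of A P"
    using D by (auto simp: dedekind_domain_def)
  define R where "R = localization A p"
  define K where "K = frac_field A"
  have K: "subfield K" unfolding K_def by (rule subfield_frac_field[OF A])
  note Kr = subringD[OF subfieldD(1)[OF K]]
  have R: "subring R" unfolding R_def by (rule subring_localization[OF A p(1)])
  note Rr = subringD[OF R]
  have AR: "A \<subseteq> R" unfolding R_def by (rule subset_localization[OF A p(1)])
  have RK: "R \<subseteq> K" unfolding R_def K_def by (rule localization_subset_frac_field[OF A p(1)])
  have maximal: "\<exists>M\<in>\<I>. \<forall>J\<in>\<I>. M \<subseteq> J \<longrightarrow> J = M"
    if "\<I> \<noteq> {}" "\<And>J. J \<in> \<I> \<Longrightarrow> ideal_of A J" for \<I>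
    by (rule noetherian_maximal_element[OF A]) (fact noeth that)+
  have pid: "ideal_of A p" using prime_ideal_ofD(1)[OF p(1)] .
  have p0: "0 \<in> p" "p \<subseteq> A" using ideal_ofD[OF pid] by auto
  define I where "I w = {r \<in> A. r * w \<in> R}" for w
  have I: "ideal_of A (I w)" for w
  proof (rule ideal_ofI[OF A])
    show "I w \<subseteq> A" "0 \<in> I w" using subringD(1)[OF A] Rr(1) by (auto simp: I_def)
    show "x + y \<in> I w" if "x \<in> I w" "y \<in> I w" for x y
      using that subringD(3)[OF A, of x y] Rr(3)[of "x * w" "y * w"] by (simp add: I_def distrib_right)
    show "r * x \<in> I w" if "r \<in> A" "x \<in> I w" for r x
      using that subringD(5)[OF A, of r x] Rr(5)[of r "x * w"] AR by (auto simp: I_def mult.assoc)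
  qed
  obtain a where a: "a \<in> p" "a \<noteq> 0" using p(2) p0 by auto
  have "inverse a \<in> K - R"
    using inverse_prime_not_in_localization[OF A p(1) a] a p0 AR RK subfieldD(2)[OF K] by (auto simp: R_def)
  then have "I ` (K - R) \<noteq> {}" by blast
  then have "\<exists>M\<in>I ` (K - R). \<forall>J\<in>I ` (K - R). M \<subseteq> J \<longrightarrow> J = M"
    by (rule maximal) (use I in auto)
  then obtain w where w: "w \<in> K" "w \<notin> R" and wmax: "\<And>w'. w' \<in> K - R \<Longrightarrow> I w \<subseteq> I w' \<Longrightarrow> I w' = I w"
    by blast
  have "prime_ideal_of A (I w)"
    unfolding prime_ideal_of_def
  proof (intro conjI ballI impI)
    show "ideal_of A (I w)" by (rule I)
    have "1 \<notin> I w" using w by (simp add: I_def)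
    then show "I w \<noteq> A" using subringD(2)[OF A] by auto
    fix r s assume rs: "r \<in> A" "s \<in> A" "r * s \<in> I w"
    show "r \<in> I w \<or> s \<in> I w"
    proof (rule disjCI)
      assume "s \<notin> I w"
      \<comment> \<open>The conductor of \<open>s * w\<close> contains that of \<open>w\<close> and
        is again admissible, so maximality makes them equal, and \<open>r\<close> lies in the
        former.\<close>
      then have "s * w \<in> K - R" using w(1) rs AR RK Kr(5)[of s w] by (auto simp: I_def)
      moreover have "I w \<subseteq> I (s * w)"
        using AR rs Rr(5) by (force simp: I_def mult.left_commute[of _ s w])
      ultimately have "I (s * w) = I w" by (rule wmax)
      moreover have "r \<in> I (s * w)" using rs by (auto simp: I_def mult.assoc)
      ultimately show "r \<in> I w" by simp
    qed
  qed
  moreover have "I w \<noteq> {0}"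
  proof -
    obtain b c where "b \<in> A" "c \<in> A" "c \<noteq> 0" "w = b / c" using w(1) by (auto simp: K_def frac_field_def)
    then have "c \<in> I w" using AR by (auto simp: I_def)
    then show ?thesis using \<open>c \<noteq> 0\<close> by auto
  qed
  ultimately have "maximal_ideal_of A (I w)" by (rule dim1)
  moreover have "I w \<subseteq> p"
  proof
    fix r assume r: "r \<in> I w"
    show "r \<in> p"
    proof (rule ccontr)
      assume "r \<notin> p"
      then have "inverse r * (r * w) \<in> R" "r \<noteq> 0"
        using r localization_inverse[OF A p(1), of r] not_in_prime_nonzero[OF A p(1), of r] Rr(5)[of "inverse r" "r * w"]
        by (auto simp: I_def R_def)
      then show False using w by (simp flip: mult.assoc)
    qed
  qed
  ultimately have Iw: "I w = p" using pid p(1) unfolding maximal_ideal_of_def prime_ideal_of_def by blast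
  have pw: "r * w \<in> R" if "r \<in> p" for r using that Iw by (auto simp: I_def)
  \<comment> \<open>If no product \<open>q * w\<close> were a unit, \<open>w\<close> would map the
    module spanned by the generators of \<open>p\<close> over \<open>R\<close> into itself and so be
    integral.\<close>
  have "\<exists>q\<in>p. q * w \<noteq> 0 \<and> inverse (q * w) \<in> R"
  proof (rule ccontr)
    assume contra: "\<not> ?thesis"
    obtain F where F: "finite F" "F \<subseteq> p" "p = ideal_gen A F" using noeth[OF pid] by auto
    have sm: "submodule R (mspan R F)" by (rule submodule_mspan[OF R])
    have "ideal_of A {r \<in> A. r \<in> mspan R F}"
      using sm AR by (intro ideal_ofI[OF A]) (auto simp: submodule_def subringD[OF A])
    moreover have "F \<subseteq> {r \<in> A. r \<in> mspan R F}" using F p0 mspan_base[OF R F(1)] by auto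
    ultimately have "p \<subseteq> {r \<in> A. r \<in> mspan R F}" using F(3) ideal_gen_minimal by metis
    then have span: "p \<subseteq> mspan R F" by auto
    have "w * r \<in> mspan R F" if "r \<in> F" for r
    proof (cases "r * w = 0")
      case True
      then show ?thesis using sm by (auto simp: submodule_def mult.commute)
    next
      case False
      have rp: "r \<in> p" using that F by auto
      then have "r * w \<in> R" "inverse (r * w) \<notin> R" using pw contra False by auto
      then obtain c s where cs: "c \<in> p" "s \<in> A - p" "r * w = c / s"
        using localization_nonunit[OF A p(1)] unfolding R_def by blast
      have "inverse s \<in> R" using cs localization_inverse[OF A p(1)] by (auto simp: R_def)
      then have "inverse s * c \<in> mspan R F" using sm span cs(1) unfolding submodule_def by blast
      then show ?thesis using cs(3) by (simp add: divide_inverse mult.commute)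
    qed
    moreover have "\<exists>r\<in>F. r \<noteq> 0"
    proof (rule ccontr)
      assume "\<not> ?thesis"
      then have "mspan R F \<subseteq> {0}" unfolding mspan_def by (auto intro!: sum.neutral)
      then show False using span a by auto
    qed
    ultimately have "integral_over R w" using integral_over_if_stable[OF R F(1)] by blast
    then show False
      using dedekind_localization_integrally_closed[OF D p(1)] w unfolding R_def K_def by blast
  qed
  then obtain q where q: "q \<in> p" "q * w \<noteq> 0" "inverse (q * w) \<in> R" by auto
  have q0: "q \<noteq> 0" and qR: "q \<in> R" using q p0 AR by auto
  have qinv: "inverse q \<notin> R"
    using inverse_prime_not_in_localization[OF A p(1) q(1) q0] by (simp add: R_def)
  have "\<exists>v. dvaluation K R v \<and> v q = 1"
  proof (rule dvaluation_exists[OF K R RK qR q0 qinv])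
    fix x assume "x \<in> R" "inverse x \<notin> R"
    then obtain c s where cs: "c \<in> p" "s \<in> A - p" "x = c / s"
      using localization_nonunit[OF A p(1)] unfolding R_def by blast
    have "inverse s \<in> R" using cs localization_inverse[OF A p(1)] by (auto simp: R_def)
    then have "inverse s * (c * w) * inverse (q * w) \<in> R" by (intro Rr(5) pw cs(1) q(3) \<open>inverse s \<in> R\<close>)
    then show "x / q \<in> R" using q cs(3) by (simp add: field_simps)
  next
    fix x assume x: "x \<in> R" "x \<noteq> 0"
    show "\<exists>k. x / q ^ k \<notin> R"
    proof (rule ccontr)
      assume "\<not> ?thesis"
      then have div: "x / q ^ k \<in> R" for k by auto
      \<comment> \<open>If \<open>q\<close> divided \<open>x\<close> in \<open>R\<close> arbitrarily
        often, the increasing conductors of \<open>q ^ k / x\<close> would still stabilize. A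
        multiple of \<open>x / q ^ Suc k\<close> by some \<open>s\<close> outside \<open>p\<close>
        lies in the conductor with index \<open>Suc k\<close>, hence in that with index
        \<open>k\<close>, and this puts \<open>s / q\<close> into \<open>R\<close>.\<close>
      define J where "J k = I (q ^ k / x)" for k
      have "range J \<noteq> {}" by blast
      then obtain k where k: "\<And>l. J k \<subseteq> J l \<Longrightarrow> J l = J k"
        using maximal[of "range J"] I by (auto simp: J_def)
      have "J k \<subseteq> J (Suc k)"
      proof
        fix r assume "r \<in> J k"
        then have "r \<in> A" "q * (r * (q ^ k / x)) \<in> R" using Rr(5)[OF qR, of "r * (q ^ k / x)"] by (auto simp: J_def I_def)
        then show "r \<in> J (Suc k)" by (simp add: J_def I_def mult.left_commute)
      qed
      then have J: "J (Suc k) = J k" by (rule k)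
      obtain s where s: "s \<in> A - p" "s * (x / q ^ Suc k) \<in> A"
        using localization_clear[OF A p(1), of "x / q ^ Suc k"] div[of "Suc k"] unfolding R_def by blast
      have "s * (x / q ^ Suc k) * (q ^ Suc k / x) = s" using q0 x by simp
      then have "s * (x / q ^ Suc k) \<in> J (Suc k)" using s AR unfolding J_def I_def by auto
      then have "s * (x / q ^ Suc k) \<in> J k" using J by simp
      then have "s * (x / q ^ Suc k) * (q ^ k / x) \<in> R" by (simp add: J_def I_def)
      also have "s * (x / q ^ Suc k) * (q ^ k / x) = s * inverse q" using q0 x by (simp add: field_simps)
      finally have "inverse s * (s * inverse q) \<in> R"
        using localization_inverse[OF A p(1)] s Rr(5) by (auto simp: R_def)
      then show False using qinv s not_in_prime_nonzero[OF A p(1), of s] by (simp flip: mult.assoc)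
    qed
  next
    fix z assume "z \<in> K"
    then show "\<exists>a\<in>R. \<exists>b\<in>R. b \<noteq> 0 \<and> z = a / b" using AR unfolding K_def frac_field_def by blast
  qed
  then show ?thesis using q(1) q0 unfolding R_def K_def by blast
qed

text \<open>The maximal ideal of \<open>localization A p\<close>, consisting of its
  nonunits.\<close>

definition loc_ideal :: "'a::field set \<Rightarrow> 'a set \<Rightarrow> 'a set" where
  "loc_ideal A p = {a / s | a s. a \<in> p \<and> s \<in> A \<and> s \<notin> p}"

context
  fixes A p :: "'a::field set"
  assumes A: "subring A" and p: "prime_ideal_of A p"
begin

lemma loc_ideal_not_unit:
  assumes "x \<in> loc_ideal A p" "x \<noteq> 0"
  shows "inverse x \<notin> localization A p"
proof
  assume x: "inverse x \<in> localization A p"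
  obtain a s where as: "a \<in> p" "s \<in> A" "s \<notin> p" "x = a / s" using assms(1) unfolding loc_ideal_def by auto
  have "inverse s * inverse x \<in> localization A p"
    using localization_inverse[OF A p as(2,3)] x subringD(5)[OF subring_localization[OF A p]] by blast
  moreover have "inverse s * inverse x = inverse a"
    using as not_in_prime_nonzero[OF A p as(3)] by (simp add: field_simps)
  ultimately show False using inverse_prime_not_in_localization[OF A p as(1)] as assms(2) by auto
qed

lemma one_not_in_loc_ideal: "1 \<notin> loc_ideal A p"
  using loc_ideal_not_unit[of 1] subringD(2)[OF subring_localization[OF A p]] by auto

lemma unit_if_not_in_loc_ideal: "x \<in> localization A p \<Longrightarrow> x \<notin> loc_ideal A p \<Longrightarrow> inverse x \<in> localization A p"
  using localization_nonunit[OF A p] unfolding loc_ideal_def by blast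

lemma ideal_of_loc_ideal: "ideal_of (localization A p) (loc_ideal A p)"
proof (rule ideal_ofI[OF subring_localization[OF A p]])
  note pI = ideal_ofD[OF prime_ideal_ofD(1)[OF p]]
  have I: "a / s \<in> loc_ideal A p" if "a \<in> p" "s \<in> A" "s \<notin> p" for a s
    using that unfolding loc_ideal_def by auto
  show "loc_ideal A p \<subseteq> localization A p"
    using pI(1) unfolding loc_ideal_def localization_def by blast
  show "0 \<in> loc_ideal A p"
    using I[of 0 1] pI(2) subringD(2)[OF A] prime_ideal_ofD(3)[OF p] by simp
  show "x + y \<in> loc_ideal A p" if "x \<in> loc_ideal A p" "y \<in> loc_ideal A p" for x y
  proof -
    obtain a s b t where xy: "x = a / s" "y = b / t" and mem: "a \<in> p" "b \<in> p" "s \<in> A" "t \<in> A" "s \<notin> p" "t \<notin> p"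
      using \<open>x \<in> loc_ideal A p\<close> \<open>y \<in> loc_ideal A p\<close> unfolding loc_ideal_def by auto
    have "x + y = (a * t + b * s) / (s * t)"
      using mem not_in_prime_nonzero[OF A p] by (auto simp: xy field_simps)
    moreover have "a * t + b * s \<in> p" "s * t \<in> A" "s * t \<notin> p"
      using mem pI(3)[OF pI(7)[of t a] pI(7)[of s b]] mult_not_in_prime[OF A p, of s t] subringD(5)[OF A] by auto
    ultimately show ?thesis using I by simp
  qed
  show "r * x \<in> loc_ideal A p" if r: "r \<in> localization A p" and x: "x \<in> loc_ideal A p" for r x
  proof -
    obtain a s where as: "r = a / s" "a \<in> A" "s \<in> A" "s \<notin> p"
      using r unfolding localization_def by blast
    obtain b t where bt: "x = b / t" "b \<in> p" "t \<in> A" "t \<notin> p"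
      using x unfolding loc_ideal_def by blast
    note xy = as(1) bt(1) and mem = as(2-) bt(2-)
    have "r * x = (a * b) / (s * t)" by (auto simp: xy)
    moreover have "a * b \<in> p" "s * t \<in> A" "s * t \<notin> p"
      using mem pI(6) mult_not_in_prime[OF A p, of s t] subringD(5)[OF A] by auto
    ultimately show ?thesis using I by simp
  qed
qed

end

section \<open>Polynomial relations and valuation rings\<close>

lemma integral_over_monic_equation:
  assumes R: "subring R" and c: "\<And>i. i < n \<Longrightarrow> c i \<in> R" and eq: "x ^ n + (\<Sum>i<n. c i * x ^ i) = 0"
  shows "integral_over R x"
proof -
  define g where "g = monom 1 n + (\<Sum>i<n. monom (c i) i)"
  have coeff_g: "coeff g i = (if i = n then 1 else if i < n then c i else 0)" for i
    unfolding g_def by (auto simp: coeff_sum)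
  then have "degree g = n" by (intro antisym degree_le le_degree) auto
  then have "lead_coeff g = 1" using coeff_g by simp
  moreover have "\<forall>i. coeff g i \<in> R" using c subringD[OF R] by (simp add: coeff_g)
  moreover have "poly g x = 0" using eq by (simp add: g_def poly_sum poly_monom)
  ultimately show ?thesis unfolding integral_over_def by blast
qed

lemma integral_over_field_if_algebraic:
  assumes K: "subfield K" and "\<And>i. i \<le> n \<Longrightarrow> c i \<in> K" "(\<Sum>i\<le>n. c i * x ^ i) = 0" "\<exists>i\<le>n. c i \<noteq> 0"
  shows "integral_over K x"
  using assms(2-)
proof (induction n)
  case 0
  then show ?case by auto
next
  case (Suc n)
  show ?case
  proof (cases "c (Suc n) = 0")
    case True
    then show ?thesis using Suc.IH Suc.prems le_Suc_eq by auto
  next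
    case False
    have "(\<Sum>i\<le>Suc n. c i / c (Suc n) * x ^ i) = 0"
      using Suc.prems(2) by (simp del: sum.atMost_Suc flip: sum_divide_distrib)
    then have "x ^ Suc n + (\<Sum>i<Suc n. c i / c (Suc n) * x ^ i) = 0"
      using False by (simp add: lessThan_Suc_atMost add.commute)
    then show ?thesis
      using subfieldD[OF K] Suc.prems(1)
      by (intro integral_over_monic_equation[of K "Suc n" "\<lambda>i. c i / c (Suc n)"]) auto
  qed
qed

text \<open>If the leading coefficient \<open>a\<close> is not a unit, then \<open>a z\<close> is integral, hence in \<open>V\<close>; it is
  either a unit, which makes \<open>1 / z\<close> an element of \<open>V\<close>, or may be absorbed into the next
  coefficient.\<close>

lemma unit_coefficient_dichotomy:
  assumes V: "subring V" "V \<subseteq> L" and L: "subfield L" and m: "ideal_of V m"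
    and unit: "\<And>x. x \<in> V \<Longrightarrow> x \<notin> m \<Longrightarrow> inverse x \<in> V"
    and closed: "\<And>x. x \<in> L \<Longrightarrow> integral_over V x \<Longrightarrow> x \<in> V"
    and z: "z \<in> L"
    and a: "\<And>i. i \<le> N \<Longrightarrow> a i \<in> V" "(\<Sum>i\<le>N. a i * z ^ i) = 0" "\<exists>i\<le>N. a i \<notin> m"
  shows "z \<in> V \<or> inverse z \<in> V"
  using a
proof (induction N arbitrary: a)
  case 0
  then show ?case using ideal_ofD(2)[OF m] by auto
next
  case (Suc N)
  note Vr = subringD[OF V(1)] and Lr = subringD[OF subfieldD(1)[OF L]]
  define w where "w = a (Suc N)"
  have wV: "w \<in> V" using Suc.prems(1) by (simp add: w_def)
  have eq: "w * z ^ Suc N + (\<Sum>i<Suc N. a i * z ^ i) = 0"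
    using Suc.prems(2) by (simp add: lessThan_Suc_atMost w_def add.commute)
  \<comment> \<open>Multiplication by the power \<open>w ^ N\<close> turns a relation with leading
    coefficient \<open>w\<close> into a monic one for \<open>w * z\<close>.\<close>
  have "(w * z) ^ Suc N + (\<Sum>i<Suc N. a i * w ^ (N - i) * (w * z) ^ i)
      = w ^ N * (w * z ^ Suc N + (\<Sum>i<Suc N. a i * z ^ i))"
  proof -
    have "(\<Sum>i<Suc N. a i * w ^ (N - i) * (w * z) ^ i) = (\<Sum>i<Suc N. w ^ N * (a i * z ^ i))"
    proof (rule sum.cong)
      fix i assume "i \<in> {..<Suc N}"
      then have "w ^ N = w ^ (N - i) * w ^ i" by (simp flip: power_add)
      then show "a i * w ^ (N - i) * (w * z) ^ i = w ^ N * (a i * z ^ i)"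
        by (simp add: power_mult_distrib)
    qed simp
    then show ?thesis by (simp add: distrib_left sum_distrib_left power_mult_distrib del: sum.lessThan_Suc)
  qed
  then have "(w * z) ^ Suc N + (\<Sum>i<Suc N. a i * w ^ (N - i) * (w * z) ^ i) = 0"
    using eq by simp
  then have "integral_over V (w * z)"
    by (rule integral_over_monic_equation[OF V(1), rotated])
      (use Suc.prems(1) wV Vr(5) subring_power[OF V(1)] in auto)
  then have wzV: "w * z \<in> V" using closed[of "w * z"] wV V(2) z Lr(5)[of w z] by auto
  show ?case
  proof (cases "w \<in> m")
    case False
    then have w0: "w \<noteq> 0" using ideal_ofD(2)[OF m] by auto
    have "inverse w * (w * z) \<in> V" by (rule Vr(5)[OF unit[OF wV False] wzV])
    then show ?thesis using w0 by (simp flip: mult.assoc)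
  next
    case wm: True
    show ?thesis
    proof (cases "w * z \<in> m")
      case False
      then have w0: "w * z \<noteq> 0" using ideal_ofD(2)[OF m] by auto
      have "inverse (w * z) * w \<in> V" by (rule Vr(5)[OF unit[OF wzV False] wV])
      then show ?thesis using w0 by (simp add: field_simps)
    next
      case wzm: True
      define b where "b i = (if i = N then a N + w * z else a i)" for i
      have "(\<Sum>i\<le>N. b i * z ^ i) = b N * z ^ N + (\<Sum>i<N. b i * z ^ i)"
        by (simp flip: lessThan_Suc_atMost)
      also have "(\<Sum>i<N. b i * z ^ i) = (\<Sum>i<N. a i * z ^ i)"
        by (rule sum.cong) (auto simp: b_def)
      also have "b N * z ^ N + \<dots> = 0" using eq by (simp add: b_def algebra_simps)
      finally have 1: "(\<Sum>i\<le>N. b i * z ^ i) = 0" .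
      have 2: "b i \<in> V" if "i \<le> N" for i using that Suc.prems(1)[of i] wzV Vr(3) by (auto simp: b_def)
      \<comment> \<open>A coefficient outside \<open>m\<close> survives: the discarded
        \<open>w\<close> lies in \<open>m\<close>, and \<open>a N\<close> changes only by
        \<open>w * z\<close>, which also lies in \<open>m\<close>.\<close>
      obtain j where j: "j \<le> Suc N" "a j \<notin> m" using Suc.prems(3) by blast
      then have "j \<le> N" using wm by (cases "j = Suc N") (auto simp: w_def)
      moreover have "b j \<notin> m"
        using j ideal_ofD(5)[OF m, of "a N + w * z" "w * z"] wzm by (auto simp: b_def)
      ultimately show ?thesis using Suc.IH[of b] 1 2 by blast
    qed
  qed
qed

lemma dvaluation_props:
  assumes v: "dvaluation F R v" and F: "subfield F"
  shows "\<And>x y. x \<in> F \<Longrightarrow> y \<in> F \<Longrightarrow> x \<noteq> 0 \<Longrightarrow> y \<noteq> 0 \<Longrightarrow> v (x * y) = v x + v y"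
    "\<And>x. x \<in> F \<Longrightarrow> x \<noteq> 0 \<Longrightarrow> 0 \<le> v x \<longleftrightarrow> x \<in> R"
    "v 1 = 0"
    "\<And>x. x \<in> F \<Longrightarrow> x \<noteq> 0 \<Longrightarrow> v (inverse x) = - v x"
    "\<And>x y. x \<in> F \<Longrightarrow> y \<in> F \<Longrightarrow> x \<noteq> 0 \<Longrightarrow> y \<noteq> 0 \<Longrightarrow> v (x / y) = v x - v y"
    "\<And>x k. x \<in> F \<Longrightarrow> x \<noteq> 0 \<Longrightarrow> v (x ^ k) = int k * v x"
proof -
  note Fr = subringD[OF subfieldD(1)[OF F]]
  show mult: "v (x * y) = v x + v y" if "x \<in> F" "y \<in> F" "x \<noteq> 0" "y \<noteq> 0" for x y
    using v that by (auto simp: dvaluation_def)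
  show "0 \<le> v x \<longleftrightarrow> x \<in> R" if "x \<in> F" "x \<noteq> 0" for x
    using v that by (auto simp: dvaluation_def)
  show one: "v 1 = 0" using mult[of 1 1] Fr by simp
  show inv: "v (inverse x) = - v x" if "x \<in> F" "x \<noteq> 0" for x
    using mult[of x "inverse x"] that subfieldD(2)[OF F] one by simp
  show "v (x / y) = v x - v y" if "x \<in> F" "y \<in> F" "x \<noteq> 0" "y \<noteq> 0" for x y
    using mult[of x "inverse y"] inv[of y] that subfieldD(2)[OF F] by (simp add: divide_inverse)
  show "v (x ^ k) = int k * v x" if "x \<in> F" "x \<noteq> 0" for x k
  proof (induction k)
    case (Suc k)
    then show ?case
      using mult[of x "x ^ k"] that subring_power[OF subfieldD(1)[OF F]] by (simp add: algebra_simps)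
  qed (simp add: one)
qed

subsection \<open>Localizations of the integral closure\<close>

lemma integral_closure_iff: "x \<in> integral_closure R L \<longleftrightarrow> x \<in> L \<and> integral_over R x"
  by (simp add: integral_closure_def)

lemma subring_Int: "subring R \<Longrightarrow> subring S \<Longrightarrow> subring (R \<inter> S)"
  by (simp add: subring_def)

lemma subring_integral_closure:
  assumes "subring R" "subring L"
  shows "subring (integral_closure R L)"
proof -
  have "integral_closure R L = L \<inter> {x. integral_over R x}" by (auto simp: integral_closure_def)
  then show ?thesis using subring_Int[OF assms(2) subring_integral[OF assms(1)]] by simp
qed

text \<open>The extension is finite through \<open>dep\<close> alone. What remains of
  \<open>A\<close> being Dedekind is dimension one, integral closedness of \<open>A_p\<close>, and
  the \<open>p\<close>-adic valuation \<open>v\<close> with a uniformizer chosen in \<open>p\<close>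
  itself.\<close>

locale dedekind_ext =
  fixes A p K L Oc :: "'a::field set" and n :: nat and v :: "'a \<Rightarrow> int" and \<pi> :: 'a
  assumes A: "subring A"
    and p: "prime_ideal_of A p"
    and dim1: "\<And>Q. prime_ideal_of A Q \<Longrightarrow> Q \<noteq> {0} \<Longrightarrow> maximal_ideal_of A Q"
    and K_eq: "K = frac_field A"
    and L: "subfield L" and KL: "K \<subseteq> L"
    and Oc_eq: "Oc = integral_closure A L"
    and dep: "\<And>J w. finite J \<Longrightarrow> card J > n \<Longrightarrow> (\<And>j. j \<in> J \<Longrightarrow> w j \<in> L) \<Longrightarrow> lin_dep K (J :: nat set) w"
    and Ap_closed: "\<And>x. x \<in> K \<Longrightarrow> integral_over (localization A p) x \<Longrightarrow> x \<in> localization A p"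
    and v: "dvaluation K (localization A p) v"
    and \<pi>: "\<pi> \<in> p" "\<pi> \<noteq> 0" "v \<pi> = 1"
begin

abbreviation "Ap \<equiv> localization A p"

lemma p_maximal: "maximal_ideal_of A p" using dim1[OF p] \<pi> by blast
lemma K: "subfield K" unfolding K_eq by (rule subfield_frac_field[OF A])
lemma AK: "A \<subseteq> K" unfolding K_eq by (rule subset_frac_field[OF A])
lemma ApK: "Ap \<subseteq> K" unfolding K_eq by (rule localization_subset_frac_field[OF A p])
lemma Ap: "subring Ap" by (rule subring_localization[OF A p])
lemma A_Ap: "A \<subseteq> Ap" by (rule subset_localization[OF A p])
lemmas Kr = subringD[OF subfieldD(1)[OF K]] and Kf = subfieldD[OF K]
lemmas Lr = subringD[OF subfieldD(1)[OF L]] and Lf = subfieldD[OF L]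
lemmas vr = dvaluation_props[OF v K]
lemma Oc: "subring Oc" unfolding Oc_eq by (rule subring_integral_closure[OF A subfieldD(1)[OF L]])
lemmas Or = subringD[OF Oc]
lemma OcL: "Oc \<subseteq> L" by (auto simp: Oc_eq integral_closure_iff)
lemma AOc: "A \<subseteq> Oc" using AK KL integral_over_base[OF A] by (auto simp: Oc_eq integral_closure_iff)
lemma pA: "p \<subseteq> A" by (rule prime_ideal_ofD(2)[OF p])
lemma \<pi>_mem: "\<pi> \<in> A" "\<pi> \<in> K" "\<pi> \<in> L" "\<pi> \<in> Oc" "\<pi> \<in> Ap"
  using \<pi>(1) pA AK KL AOc A_Ap by auto

lemma v_inverse_\<pi>: "inverse \<pi> \<notin> Ap"
  using vr(2)[of "inverse \<pi>"] vr(4)[of \<pi>] Kf(2) \<pi> \<pi>_mem by auto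

text \<open>Divide by a coefficient of least value. The coefficient 1 keeps the relation nontrivial
  modulo every proper ideal.\<close>

lemma lin_dep_normalized:
  assumes J: "finite J" and w: "lin_dep K J w"
  shows "\<exists>c. (\<forall>j\<in>J. c j \<in> Ap) \<and> (\<exists>j\<in>J. c j = 1) \<and> (\<Sum>j\<in>J. c j * w j) = 0"
proof -
  obtain c where c: "\<forall>j\<in>J. c j \<in> K" "\<exists>j\<in>J. c j \<noteq> 0" "(\<Sum>j\<in>J. c j * w j) = 0"
    using w unfolding lin_dep_def by blast
  define J' where "J' = {j \<in> J. c j \<noteq> 0}"
  have "finite J'" "J' \<noteq> {}" using J c(2) by (auto simp: J'_def)
  then obtain k where k: "k \<in> J'" "\<And>j. j \<in> J' \<Longrightarrow> v (c k) \<le> v (c j)"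
    using ex_min_if_finite[of "(\<lambda>j. v (c j)) ` J'"] by (fastforce simp: not_less)
  have kJ: "k \<in> J" "c k \<noteq> 0" "c k \<in> K" using k(1) c(1) by (auto simp: J'_def)
  have "c j / c k \<in> Ap" if "j \<in> J" for j
  proof (cases "c j = 0")
    case True
    then show ?thesis using subringD(1)[OF Ap] by simp
  next
    case False
    have cj: "c j \<in> K" using c(1) that by blast
    have "v (c j / c k) = v (c j) - v (c k)" using vr(5)[OF cj kJ(3) False kJ(2)] .
    then have "0 \<le> v (c j / c k)" using k(2)[of j] False that by (simp add: J'_def)
    then show ?thesis using vr(2)[of "c j / c k"] Kf(3)[OF cj kJ(3)] False kJ(2) by simp
  qed
  moreover have "(\<Sum>j\<in>J. c j / c k * w j) = 0"
    using c(3) by (simp add: mult.commute[of _ "w _"] flip: sum_divide_distrib)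
  moreover have "c k / c k = 1" using kJ by simp
  ultimately show ?thesis using kJ(1) by (intro exI[of _ "\<lambda>j. c j / c k"]) blast
qed

text \<open>A common denominator \<open>s\<close> outside \<open>p\<close> clears the normalized
  relation, and the coefficient 1 becomes \<open>s\<close>.\<close>

lemma lin_dep_normalized_A:
  assumes J: "finite J" and w: "lin_dep K J w"
  shows "\<exists>c. (\<forall>j\<in>J. c j \<in> A) \<and> (\<exists>j\<in>J. c j \<notin> p) \<and> (\<Sum>j\<in>J. c j * w j) = 0"
proof -
  obtain c k where c: "\<forall>j\<in>J. c j \<in> Ap" "k \<in> J" "c k = 1" "(\<Sum>j\<in>J. c j * w j) = 0"
    using lin_dep_normalized[OF assms] by blast
  have "\<exists>s\<in>A - p. \<forall>j\<in>J. s * c j \<in> A"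
  proof (rule common_denominator[OF A _ _ _ _ J])
    show "1 \<in> A - p" using subringD(2)[OF A] prime_ideal_ofD(3)[OF p] by simp
    show "s * t \<in> A - p" if "s \<in> A - p" "t \<in> A - p" for s t
      using that mult_not_in_prime[OF A p, of s t] subringD(5)[OF A, of s t] by simp
    show "0 \<notin> A - p" using not_in_prime_nonzero[OF A p] by auto
    show "\<exists>s\<in>A - p. s * c j \<in> A" if "j \<in> J" for j
      using localization_clear[OF A p] c(1) that by blast
  qed auto
  then obtain s where s: "s \<in> A - p" "\<forall>j\<in>J. s * c j \<in> A" by blast
  have "(\<Sum>j\<in>J. s * c j * w j) = s * (\<Sum>j\<in>J. c j * w j)"
    by (simp add: sum_distrib_left mult.assoc)
  moreover have "s * c k \<notin> p" using s(1) c(3) by simp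
  ultimately show ?thesis
    using s(2) c(2,4) by (intro exI[of _ "\<lambda>j. s * c j"]) auto
qed

lemma powers_lin_dep: "z \<in> L \<Longrightarrow> lin_dep K {..n} (\<lambda>i. z ^ i)"
  by (rule dep) (auto intro: subring_power[OF Lf(1)])

lemma integral_denominator:
  assumes z: "z \<in> L"
  shows "\<exists>d\<in>A - {0}. d * z \<in> Oc"
proof -
  obtain c where "\<forall>i\<in>{..n}. c i \<in> K" "\<exists>i\<in>{..n}. c i \<noteq> 0" "(\<Sum>i\<in>{..n}. c i * z ^ i) = 0"
    using powers_lin_dep[OF z] unfolding lin_dep_def by blast
  then have "integral_over K z"
    by (intro integral_over_field_if_algebraic[OF K, of n c]) auto
  then obtain d where d: "d \<in> A - {0}" "integral_over A (d * z)"
    using integral_over_localization[OF A prime_ideal_of_zero[OF A]]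
    unfolding K_eq frac_field_eq_localization by blast
  have "d \<in> L" using d(1) AK KL by auto
  then have "d * z \<in> Oc" using Lr(5) z d by (simp add: Oc_eq integral_closure_iff)
  then show ?thesis using d(1) by blast
qed

end

section \<open>The local ring at a prime over \<open>p\<close> and its value group\<close>

locale prime_over = dedekind_ext +
  fixes P :: "'a set"
  assumes P_over: "P \<in> primes_over A p Oc"
begin

abbreviation "V \<equiv> localization Oc P"
abbreviation "m \<equiv> loc_ideal Oc P"

lemma P: "prime_ideal_of Oc P" and PA: "P \<inter> A = p"
  using P_over by (auto simp: primes_over_def)

lemma V: "subring V" by (rule subring_localization[OF Oc P])
lemmas Vr = subringD[OF V]
lemma OcV: "Oc \<subseteq> V" by (rule subset_localization[OF Oc P])
lemma m: "ideal_of V m" by (rule ideal_of_loc_ideal[OF Oc P])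
lemmas mI = ideal_ofD[OF m]
lemma one_notin_m: "1 \<notin> m" by (rule one_not_in_loc_ideal[OF Oc P])
lemmas unit = unit_if_not_in_loc_ideal[OF Oc P] and not_unit = loc_ideal_not_unit[OF Oc P]

lemma VL: "V \<subseteq> L"
proof
  fix x assume "x \<in> V"
  then obtain a s where "a \<in> Oc" "s \<in> Oc" "x = a / s" unfolding localization_def by blast
  then show "x \<in> L" using OcL Lf(3) by blast
qed

lemma P_in_m: "x \<in> P \<Longrightarrow> x \<in> m"
proof -
  assume "x \<in> P"
  moreover have "x = x / 1" by simp
  ultimately show "x \<in> m" unfolding loc_ideal_def using Or(2) prime_ideal_ofD(3)[OF P] by blast
qed

lemma \<pi>_in_m: "\<pi> \<in> m"
  using P_in_m PA \<pi>(1) by blast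

lemma Ap_V: "Ap \<subseteq> V"
proof
  fix x assume "x \<in> Ap"
  then obtain a s where as: "a \<in> A" "s \<in> A" "s \<notin> p" "x = a / s" unfolding localization_def by blast
  then have "s \<notin> P" using PA by blast
  then show "x \<in> V" using localizationI[OF Oc P, of a s] as AOc by blast
qed

lemma V_integrally_closed:
  assumes "x \<in> L" "integral_over V x"
  shows "x \<in> V"
proof -
  obtain s where s: "s \<in> Oc - P" "integral_over Oc (s * x)"
    using integral_over_localization[OF Oc P assms(2)] by blast
  have "integral_over A (s * x)"
    using integral_over_trans[OF A _ s(2)] by (auto simp: Oc_eq integral_closure_iff)
  moreover have "s * x \<in> L" using s(1) OcL assms(1) Lr(5) by blast
  ultimately show ?thesis
    using localization_unclear[OF Oc P s(1)] by (simp add: Oc_eq integral_closure_iff)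
qed

text \<open>The normalized relation between the powers of \<open>z\<close> has a coefficient 1,
  hence one outside \<open>m\<close>, and the dichotomy applies.\<close>

lemma V_valuation_ring:
  assumes z: "z \<in> L"
  shows "z \<in> V \<or> inverse z \<in> V"
proof -
  obtain c k where c: "\<forall>j\<in>{..n}. c j \<in> Ap" "k \<in> {..n}" "c k = 1" "(\<Sum>j\<in>{..n}. c j * z ^ j) = 0"
    using lin_dep_normalized[OF _ powers_lin_dep[OF z]] by blast
  show ?thesis
  proof (rule unit_coefficient_dichotomy[OF V VL L m unit V_integrally_closed z])
    show "c i \<in> V" if "i \<le> n" for i using c(1) Ap_V that by blast
    show "\<exists>i\<le>n. c i \<notin> m" using c(2,3) one_notin_m by auto
  qed (use c(4) in auto)
qed

text \<open>Read elements up to units of \<open>V\<close> as values: \<open>r\<close> lies strictly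
  between 0 and the value of \<open>\<pi>\<close>, whereas elements of \<open>K\<close> have values
  that are multiples of it, according to \<open>v q \<le> 0\<close> or
  \<open>v q \<ge> 1\<close>.\<close>

lemma chain_ratio_not_in_K:
  assumes r: "r \<noteq> 0" "r \<in> m" "\<pi> / r \<in> m" and q: "q \<in> K" "q \<noteq> 0"
  shows "\<not> (r / q \<in> V \<and> q / r \<in> V)"
proof
  assume rq: "r / q \<in> V \<and> q / r \<in> V"
  show False
  proof (cases "v q \<le> 0")
    case True
    then have "inverse q \<in> Ap" using vr(2)[of "inverse q"] vr(4)[OF q] Kf(2)[OF q(1)] q(2) by simp
    then have "inverse q * (q / r) \<in> V" using Ap_V Vr(5) rq by blast
    then show False using not_unit[OF r(2,1)] q(2) by (simp add: field_simps)
  next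
    case False
    then have "0 \<le> v (q / \<pi>)" using vr(5)[OF q(1) \<pi>_mem(2) q(2) \<pi>(2)] \<pi>(3) by simp
    then have "q / \<pi> \<in> Ap" using vr(2)[of "q / \<pi>"] Kf(3)[OF q(1) \<pi>_mem(2)] q(2) \<pi>(2) by simp
    then have "r / q * (q / \<pi>) \<in> V" using Ap_V Vr(5) rq by blast
    then have "inverse (\<pi> / r) \<in> V" using q(2) by (simp add: field_simps)
    then show False using not_unit[OF r(3)] r(1) \<pi>(2) by simp
  qed
qed

text \<open>Divisibility in a valuation ring is total, so a finite set has a least value; quotients
  stand in for the valuation, which is yet to be constructed.\<close>

lemma finite_minimal_valuation:
  assumes "finite S" "S \<noteq> {}" "\<And>j. j \<in> S \<Longrightarrow> t j \<in> L \<and> t j \<noteq> 0"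
  shows "\<exists>k\<in>S. \<forall>j\<in>S. t j / t k \<in> V"
  using assms
proof (induction S rule: finite_ne_induct)
  case (singleton x)
  then show ?case using Vr(2) by auto
next
  case (insert x S)
  then obtain k where k: "k \<in> S" "\<forall>j\<in>S. t j / t k \<in> V" by blast
  have xk: "t x / t k \<in> L" "t x \<noteq> 0" "t k \<noteq> 0" using insert.prems k(1) Lf(3) by auto
  show ?case
  proof (cases "t x / t k \<in> V")
    case True
    then show ?thesis using k by blast
  next
    case False
    then have kx: "t k / t x \<in> V" using V_valuation_ring[OF xk(1)] by (simp add: field_simps)
    have "t j / t x \<in> V" if "j \<in> S" for j
    proof -
      have "t j / t k * (t k / t x) \<in> V" by (rule Vr(5)) (use k that kx in auto)
      then show ?thesis using xk by simp
    qed
    moreover have "t x / t x \<in> V" using xk Vr(2) by simp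
    ultimately show ?thesis by blast
  qed
qed

text \<open>The values of the chain lie in distinct classes modulo \<open>v(K)\<close>, so more than \<open>n\<close> of its elements
  would be linearly independent over \<open>K\<close>.\<close>

lemma no_infinite_chain:
  assumes y: "\<And>i::nat. y i \<in> m" "\<And>i. y i \<noteq> 0" "\<And>i. y i / y (Suc i) \<in> m" "y 0 = \<pi>"
  shows False
proof -
  have mV: "x \<in> V" if "x \<in> m" for x using that mI(1) by blast
  have yL: "y i \<in> L" for i using y(1) mV VL by blast
  have ratio: "y i / y j \<in> m" if "i < j" for i j
    using that
  proof (induction j)
    case (Suc j)
    show ?case
    proof (cases "i = j")
      case False
      then have "y i / y j * (y j / y (Suc j)) \<in> m" using Suc y(3) mV by (intro mI(6)) auto
      then show ?thesis using y(2) by simp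
    qed (use y(3) in simp)
  qed simp
  \<comment> \<open>The quotient equals \<open>y 0 / y i * y j\<close>, a multiple of
    \<open>y j\<close>; so ratios of chain members also lie strictly between 0 and the value of
    \<open>\<pi>\<close>.\<close>
  have ratio': "\<pi> / (y i / y j) \<in> m" if "i < j" for i j
  proof -
    have "y 0 / y i \<in> V" using ratio[of 0 i] y(2)[of 0] Vr(2) mV by (cases "i = 0") auto
    then have "y 0 / y i * y j \<in> m" by (rule mI(6)[OF _ y(1)])
    then show ?thesis by (simp add: y(4) field_simps)
  qed
  have "lin_dep K {..n} y" using yL by (intro dep) auto
  then obtain c where c: "\<forall>j\<in>{..n}. c j \<in> K" "\<exists>j\<in>{..n}. c j \<noteq> 0" "(\<Sum>j\<in>{..n}. c j * y j) = 0"
    unfolding lin_dep_def by blast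
  define S where "S = {j\<in>{..n}. c j \<noteq> 0}"
  define t where "t j = c j * y j" for j
  have tS: "t j \<in> L \<and> t j \<noteq> 0" if "j \<in> S" for j
    using that c(1) KL yL y(2) Lr(5) by (auto simp: S_def t_def)
  have finS: "finite S" and "S \<noteq> {}" using c(2) by (auto simp: S_def)
  then obtain k where k: "k \<in> S" "\<forall>j\<in>S. t j / t k \<in> V"
    using finite_minimal_valuation[of S t] tS by blast
  \<comment> \<open>Two terms of equal value would give a ratio of chain members the value of an
    element of \<open>K\<close>.\<close>
  have "t j / t k \<in> m" if j: "j \<in> S" "j \<noteq> k" for j
  proof (rule ccontr)
    assume "t j / t k \<notin> m"
    then have "inverse (t j / t k) \<in> V" using unit k(2) j by blast
    then have kj: "t k / t j \<in> V" by simp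
    have ck: "c k \<in> K" "c j \<in> K" "c k \<noteq> 0" "c j \<noteq> 0" using c(1) k(1) j(1) by (auto simp: S_def)
    show False
    proof (cases "j < k")
      case True
      have "y j / y k / (c k / c j) = t j / t k" "c k / c j / (y j / y k) = t k / t j"
        by (simp_all add: t_def mult.commute)
      then show False
        using chain_ratio_not_in_K[OF _ ratio[OF True] ratio'[OF True], of "c k / c j"] kj k(2) j ck y(2) Kf(3) by auto
    next
      case False
      then have less: "k < j" using j(2) by simp
      have "y k / y j / (c j / c k) = t k / t j" "c j / c k / (y k / y j) = t j / t k"
        by (simp_all add: t_def mult.commute)
      then show False
        using chain_ratio_not_in_K[OF _ ratio[OF less] ratio'[OF less], of "c j / c k"] kj k(2) j ck y(2) Kf(3) by auto
    qed
  qed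
  moreover have mmod: "submodule V m" using mI(2,3,6) by (auto simp: submodule_def)
  ultimately have "(\<Sum>j\<in>S - {k}. t j / t k) \<in> m" by (intro submodule_sum) auto
  moreover have "(\<Sum>j\<in>S - {k}. t j / t k) = - 1"
  proof -
    have "(\<Sum>j\<in>S. t j) = 0"
      using c(3) by (subst sum.mono_neutral_left[of "{..n}" S]) (auto simp: S_def t_def)
    then have "(\<Sum>j\<in>S. t j / t k) = 0" by (simp flip: sum_divide_distrib)
    then have "t k / t k + (\<Sum>j\<in>S - {k}. t j / t k) = 0" using sum.remove[OF finS k(1)] by metis
    then show ?thesis using tS[OF k(1)] by (simp add: add_eq_0_iff)
  qed
  ultimately show False using one_notin_m mI(4) by force
qed

text \<open>Without an element of least value in \<open>m\<close>, one could descend from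
  \<open>\<pi>\<close> through elements of \<open>m\<close> forever.\<close>

lemma m_principal: "\<exists>t\<in>m. t \<noteq> 0 \<and> (\<forall>x\<in>m. x / t \<in> V)"
proof (rule ccontr)
  assume contra: "\<not> ?thesis"
  have step: "\<exists>y. (y \<in> m \<and> y \<noteq> 0) \<and> x / y \<in> m" if x: "x \<in> m" "x \<noteq> 0" for x
  proof -
    obtain y where y: "y \<in> m" "y / x \<notin> V" using contra x by blast
    have y0: "y \<noteq> 0" using y(2) Vr(1) by auto
    have "y / x \<in> L" using y x mI(1) VL Lf(3) by blast
    then have "x / y \<in> V" using V_valuation_ring[of "y / x"] y(2) by simp
    moreover have "x / y \<in> m" using unit[OF \<open>x / y \<in> V\<close>] y(2) by auto
    ultimately show ?thesis using y y0 by blast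
  qed
  have "\<exists>y. \<forall>i. (y i \<in> m \<and> y i \<noteq> 0 \<and> (i = 0 \<longrightarrow> y i = \<pi>)) \<and> y i / y (Suc i) \<in> m"
    by (rule dependent_nat_choice) (use \<pi>_in_m \<pi>(2) step in auto)
  then show False using no_infinite_chain by blast
qed

lemma exists_valuation: "\<exists>w. dvaluation L V w"
proof -
  obtain t where t: "t \<in> m" "t \<noteq> 0" "\<And>x. x \<in> m \<Longrightarrow> x / t \<in> V" using m_principal by blast
  have tV: "t \<in> V" using t(1) mI(1) by blast
  have \<pi>_sep: "\<exists>k. \<pi> / t ^ k \<notin> V"
  proof (rule ccontr)
    assume "\<not> ?thesis"
    then have all: "\<pi> / t ^ k \<in> V" for k by blast
    show False
    proof (rule no_infinite_chain[of "\<lambda>i. \<pi> / t ^ i"])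
      fix i
      have "\<pi> / t ^ Suc i * t \<in> m" by (rule mI(6)[OF all t(1)])
      then show "\<pi> / t ^ i \<in> m" using t(2) by (simp add: field_simps)
      have "\<pi> / t ^ i / (\<pi> / t ^ Suc i) = t" using t(2) \<pi>(2) by simp
      then show "\<pi> / t ^ i / (\<pi> / t ^ Suc i) \<in> m" using t(1) by simp
    qed (use t(2) \<pi>(2) in auto)
  qed
  define M where "M = (LEAST k. \<pi> / t ^ k \<notin> V)"
  have M: "\<pi> / t ^ M \<notin> V" unfolding M_def using \<pi>_sep by (rule LeastI_ex)
  then obtain e where e: "M = Suc e" using mI(1) \<pi>_in_m by (cases M) auto
  \<comment> \<open>Here \<open>e\<close> is the largest exponent with
    \<open>\<pi> / t ^ e \<in> V\<close>, the ramification index to be, so \<open>w\<close> is a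
    unit.\<close>
  define w where "w = \<pi> / t ^ e"
  have wV: "w \<in> V" using not_less_Least[of e "\<lambda>k. \<pi> / t ^ k \<notin> V"] e unfolding w_def M_def by simp
  have "w / t \<notin> V" using M e by (simp add: w_def mult.commute)
  then have "w \<notin> m" using t(3) by blast
  then have winv: "inverse w \<in> V" by (rule unit[OF wV])
  have w0: "w \<noteq> 0" using \<pi>(2) t(2) by (simp add: w_def)
  \<comment> \<open>A denominator in \<open>A\<close> of \<open>1 / x\<close> shows that
    \<open>x\<close> divides a power \<open>\<pi> ^ k\<close> in \<open>V\<close>. Since
    \<open>\<pi> ^ k = w ^ k * t ^ (e * k)\<close> with \<open>w\<close> a unit, \<open>x\<close>
    cannot be divisible by \<open>t ^ Suc (e * k)\<close>.\<close>
  have sep: "\<exists>k. x / t ^ k \<notin> V" if x: "x \<in> V" "x \<noteq> 0" for x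
  proof (rule ccontr)
    assume "\<not> ?thesis"
    then have all: "x / t ^ k \<in> V" for k by blast
    have "inverse x \<in> L" using x VL Lf(2) by blast
    then obtain d where d: "d \<in> A - {0}" "d * inverse x \<in> Oc" using integral_denominator by blast
    then have dK: "d \<in> K" "d \<noteq> 0" "d \<in> Ap" using AK A_Ap by auto
    define k where "k = nat (v d)"
    have "0 \<le> v d" using vr(2)[OF dK(1,2)] dK(3) by simp
    then have "v (\<pi> ^ k / d) = 0"
      using vr(5)[of "\<pi> ^ k" d] vr(6)[of \<pi> k] dK \<pi> \<pi>_mem(2) subring_power[OF Kf(1)] by (simp add: k_def)
    then have "\<pi> ^ k / d \<in> Ap"
      using vr(2)[of "\<pi> ^ k / d"] dK \<pi> \<pi>_mem(2) subring_power[OF Kf(1)] Kf(3) by simp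
    then have "\<pi> ^ k / d * (d * inverse x) \<in> V" using Ap_V d(2) OcV Vr(5) by blast
    then have "\<pi> ^ k / x \<in> V" using dK(2) by (simp add: field_simps)
    then have "(\<pi> ^ k / x) * (x / t ^ Suc (e * k)) \<in> V" by (rule Vr(5)[OF _ all])
    then have "\<pi> ^ k / t ^ Suc (e * k) \<in> V" using x(2) by simp
    moreover have "\<pi> ^ k / t ^ Suc (e * k) = w ^ k / t"
      by (simp add: w_def power_divide mult.commute flip: power_mult)
    ultimately have "w ^ k / t \<in> V" by simp
    then have "inverse w ^ k * (w ^ k / t) \<in> V" by (rule Vr(5)[OF subring_power[OF V winv]])
    moreover have "inverse w ^ k * (w ^ k / t) = inverse t"
      using w0 by (simp add: field_simps)
    ultimately show False using not_unit[OF t(1,2)] by simp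
  qed
  have "\<exists>u. dvaluation L V u \<and> u t = 1"
  proof (rule dvaluation_exists[OF L V VL tV t(2) not_unit[OF t(1,2)] _ sep])
    show "x / t \<in> V" if "x \<in> V" "inverse x \<notin> V" for x using t(3) unit that by blast
    show "\<exists>a\<in>V. \<exists>b\<in>V. b \<noteq> 0 \<and> z = a / b" if z: "z \<in> L" for z
    proof (cases "z \<in> V")
      case True
      then show ?thesis using Vr(2) by (intro bexI[of _ z] bexI[of _ 1]) auto
    next
      case False
      then have "inverse z \<in> V" "z \<noteq> 0" using V_valuation_ring[OF z] Vr(1) by auto
      then show ?thesis using Vr(2) by (intro bexI[of _ 1] bexI[of _ "inverse z"]) (auto simp: field_simps)
    qed
  qed
  then show ?thesis by blast
qed

end

subsection \<open>The valuation of a prime over \<open>p\<close>\<close>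

lemma ideal_of_ideal_pow:
  assumes R: "subring R" and P: "ideal_of R P"
  shows "ideal_of R (ideal_pow R P k)"
proof (induction k)
  case (Suc k)
  have "{x * y |x y. x \<in> P \<and> y \<in> ideal_pow R P k} \<subseteq> R"
    using ideal_ofD(1)[OF P] ideal_ofD(1)[OF Suc] subringD(5)[OF R] by blast
  then show ?case by (simp add: ideal_mult_def ideal_of_ideal_gen[OF R])
qed (simp add: ideal_of_self[OF R])

lemma ideal_pow_Suc_mult: "x \<in> P \<Longrightarrow> y \<in> ideal_pow R P k \<Longrightarrow> x * y \<in> ideal_pow R P (Suc k)"
  unfolding ideal_pow.simps ideal_mult_def using ideal_gen_base by fastforce

lemma power_mem_ideal_pow: "subring R \<Longrightarrow> x \<in> P \<Longrightarrow> x ^ k \<in> ideal_pow R P k"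
  by (induction k) (auto simp: subringD simp del: ideal_pow.simps(2) intro: ideal_pow_Suc_mult)

context prime_over
begin

lemmas PI = ideal_ofD[OF prime_ideal_ofD(1)[OF P]]

text \<open>An element of \<open>Oc\<close> outside \<open>P\<close> satisfies over \<open>A\<close> a monic equation modulo \<open>P\<close> of least degree,
  whose constant term is then outside \<open>p\<close>, hence invertible modulo \<open>p\<close>.\<close>

lemma inverse_mod_P:
  assumes x: "x \<in> Oc" "x \<notin> P"
  shows "\<exists>y\<in>Oc. 1 - x * y \<in> P"
proof -
  define Q where "Q d \<longleftrightarrow> (\<exists>c. (\<forall>i<d. c i \<in> A) \<and> x ^ d + (\<Sum>i<d. c i * x ^ i) \<in> P)" for d :: nat
  have "integral_over A x" using x(1) by (simp add: Oc_eq integral_closure_iff)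
  then obtain g where g: "\<And>i. coeff g i \<in> A" "lead_coeff g = 1" "poly g x = 0"
    by (auto simp: integral_over_def)
  have "Q (degree g)"
    unfolding Q_def using g PI(2)
    by (intro exI[of _ "coeff g"]) (auto simp: poly_altdef add.commute simp flip: lessThan_Suc_atMost)
  define d where "d = (LEAST d. Q d)"
  have "Q d" unfolding d_def using \<open>Q (degree g)\<close> by (rule LeastI)
  then obtain c where c: "\<And>i. i < d \<Longrightarrow> c i \<in> A" "x ^ d + (\<Sum>i<d. c i * x ^ i) \<in> P"
    unfolding Q_def by blast
  have "d \<noteq> 0" using c(2) prime_ideal_ofD(3)[OF P] by (cases d) auto
  then obtain e where e: "d = Suc e" by (cases d) auto
  define h where "h = x ^ e + (\<Sum>i<e. c (Suc i) * x ^ i)"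
  have hO: "h \<in> Oc"
    unfolding h_def using c(1) e AOc
    by (intro Or(3) subring_sum[OF Oc] Or(5) subring_power[OF Oc x(1)]) auto
  have "x ^ d + (\<Sum>i<d. c i * x ^ i) = x * h + c 0"
    unfolding e h_def sum.lessThan_Suc_shift by (simp add: sum_distrib_left algebra_simps)
  then have eq: "x * h + c 0 \<in> P" using c(2) by simp
  have c0: "c 0 \<in> A" using c(1) e by simp
  \<comment> \<open>Otherwise \<open>x * h \<in> P\<close>, and as \<open>x \<notin> P\<close>, the
    shorter monic expression \<open>h\<close> is in \<open>P\<close>, against the minimality of
    \<open>d\<close>.\<close>
  have "c 0 \<notin> p"
  proof
    assume "c 0 \<in> p"
    then have "c 0 \<in> P" using PA by blast
    then have "x * h \<in> P" using PI(5)[OF eq, of "c 0"] by simp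
    then have "h \<in> P" using prime_ideal_ofD(4)[OF P x(1) hO] x(2) by blast
    then have "Q e" unfolding Q_def h_def using c(1) e by (intro exI[of _ "\<lambda>i. c (Suc i)"]) auto
    then show False using not_less_Least[of e Q] e d_def by auto
  qed
  then have "{q + a * c 0 | q a. q \<in> p \<and> a \<in> A} = A"
    using p_maximal ideal_plus_principal[OF A prime_ideal_ofD(1)[OF p] c0]
    unfolding maximal_ideal_of_def by blast
  then have "1 \<in> {q + a * c 0 | q a. q \<in> p \<and> a \<in> A}" using subringD(2)[OF A] by simp
  then obtain a q where aq: "1 = q + a * c 0" "a \<in> A" "q \<in> p" by blast
  have "q + (x * h + c 0) * a \<in> P"
    using aq PA AOc by (intro PI(3) PI(7)[OF _ eq]) auto
  also have "q + (x * h + c 0) * a = 1 - x * (- (h * a))" using aq(1) by (simp add: algebra_simps)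
  finally have "1 - x * (- (h * a)) \<in> P" .
  moreover have "- (h * a) \<in> Oc" using hO aq(2) AOc by (intro Or(6) Or(5)) auto
  ultimately show ?thesis by blast
qed

text \<open>The quotient of \<open>Oc\<close> by \<open>P\<close> is a field, so nothing proper lies
  above \<open>P\<close>.\<close>

lemma P_eq_if_subset:
  assumes "prime_over A p K L Oc n v \<pi> P'" "P \<subseteq> P'"
  shows "P = P'"
proof (rule ccontr)
  interpret P': prime_over A p K L Oc n v \<pi> P' by (rule assms(1))
  assume "P \<noteq> P'"
  then obtain x where x: "x \<in> P'" "x \<notin> P" using assms(2) by blast
  then obtain y where y: "y \<in> Oc" "1 - x * y \<in> P" using inverse_mod_P P'.PI(1) by blast
  then have "x * y \<in> P'" "1 - x * y \<in> P'" using assms(2) P'.PI(7)[OF y(1) x(1)] by auto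
  then have "1 \<in> P'" using P'.PI(3) by fastforce
  then show False using prime_ideal_ofD(3)[OF P'.P] by simp
qed

text \<open>Errors multiply: an inverse with error in \<open>P\<close> and one with error in the
  \<open>k\<close>-th power combine to one with error in the next power.\<close>

lemma inverse_mod_ideal_pow:
  assumes s: "s \<in> Oc" "s \<notin> P"
  shows "\<exists>d\<in>Oc. 1 - s * d \<in> ideal_pow Oc P k"
proof (induction k)
  case 0
  then show ?case using Or by (auto intro!: bexI[of _ 0])
next
  case (Suc k)
  then obtain d where d: "d \<in> Oc" "1 - s * d \<in> ideal_pow Oc P k" by blast
  obtain y where y: "y \<in> Oc" "1 - s * y \<in> P" using inverse_mod_P[OF s] by blast
  have "(1 - s * y) * (1 - s * d) \<in> ideal_pow Oc P (Suc k)"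
    by (rule ideal_pow_Suc_mult[OF y(2) d(2)])
  also have "(1 - s * y) * (1 - s * d) = 1 - s * (y + d - s * y * d)"
    by (simp add: algebra_simps)
  finally have "1 - s * (y + d - s * y * d) \<in> ideal_pow Oc P (Suc k)" .
  moreover have "y + d - s * y * d \<in> Oc" by (intro Or(3,4,5) y(1) d(1) s(1))
  ultimately show ?case by blast
qed

text \<open>On nonzero elements of \<open>L\<close> the choice is immaterial, since
  \<open>val_at_eq\<close> identifies \<open>u\<close> with \<open>val_at\<close>.\<close>

definition u :: "'a \<Rightarrow> int" where "u = (SOME w. dvaluation L V w)"

lemma u: "dvaluation L V u"
  unfolding u_def using exists_valuation by (rule someI_ex)

lemmas ur = dvaluation_props[OF u L]

lemma u_P: "x \<in> P \<Longrightarrow> x \<noteq> 0 \<Longrightarrow> 1 \<le> u x"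
proof -
  assume x: "x \<in> P" "x \<noteq> 0"
  then have xL: "x \<in> L" using PI(1) OcL by blast
  have "inverse x \<notin> V" by (rule not_unit[OF P_in_m[OF x(1)] x(2)])
  then have "\<not> 0 \<le> u (inverse x)" using ur(2)[of "inverse x"] Lf(2)[OF xL] x(2) by simp
  then show ?thesis using ur(4)[OF xL x(2)] by simp
qed

lemma u_not_P: "x \<in> Oc \<Longrightarrow> x \<notin> P \<Longrightarrow> u x = 0"
proof -
  assume x: "x \<in> Oc" "x \<notin> P"
  then have x0: "x \<noteq> 0" and xL: "x \<in> L" using PI(2) OcL by auto
  have "inverse x \<in> V" using localization_inverse[OF Oc P x] .
  then show ?thesis
    using ur(2)[OF xL x0] ur(2)[of "inverse x"] ur(4)[OF xL x0] x(1) OcV x0 Lf(2)[OF xL] by auto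
qed

lemma u_Oc: "x \<in> Oc \<Longrightarrow> x \<noteq> 0 \<Longrightarrow> 0 \<le> u x"
  using ur(2)[of x] OcV OcL by blast

lemma uniformizer: "\<exists>t\<in>P. t \<noteq> 0 \<and> u t = 1"
proof -
  obtain t where t: "t \<in> L" "t \<noteq> 0" "u t = 1" using u unfolding dvaluation_def by blast
  then have "t \<in> V" using ur(2)[of t] by simp
  then obtain a s where as: "a \<in> Oc" "s \<in> Oc" "s \<notin> P" "t = a / s" unfolding localization_def by blast
  have s0: "s \<noteq> 0" and a0: "a \<noteq> 0" using not_in_prime_nonzero[OF Oc P as(3)] t(2) as(4) by auto
  have "u t = u a - u s" unfolding as(4) using as OcL s0 a0 by (intro ur(5)) auto
  then have "u a = 1" using u_not_P[OF as(2,3)] t(3) by simp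
  then show ?thesis using u_not_P[OF as(1)] a0 by (intro bexI[of _ a]) auto
qed

text \<open>With a uniformizer \<open>t\<close> the condition becomes
  \<open>a / t ^ k \<in> V\<close>, so closure under addition is that of \<open>V\<close>.\<close>

lemma valuation_ideal: "ideal_of Oc {a \<in> Oc. a = 0 \<or> int k \<le> u a}"
proof -
  obtain t where t: "t \<in> P" "t \<noteq> 0" "u t = 1" using uniformizer by blast
  have tL: "t ^ k \<in> L" "t ^ k \<noteq> 0" "u (t ^ k) = int k"
    using t ur(6)[of t k] PI(1) OcL subring_power[OF Lf(1)] by auto
  have iff: "a = 0 \<or> int k \<le> u a \<longleftrightarrow> a / t ^ k \<in> V" if "a \<in> Oc" for a
  proof (cases "a = 0")
    case True
    then show ?thesis using Vr(1) by simp
  next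
    case False
    have aL: "a \<in> L" using that OcL by blast
    show ?thesis using ur(2)[of "a / t ^ k"] ur(5)[OF aL tL(1) False tL(2)] tL Lf(3)[OF aL tL(1)] False by simp
  qed
  have eq: "{a \<in> Oc. a = 0 \<or> int k \<le> u a} = {a \<in> Oc. a / t ^ k \<in> V}" using iff by blast
  show ?thesis
    unfolding eq
  proof (rule ideal_ofI[OF Oc])
    show "0 \<in> {a \<in> Oc. a / t ^ k \<in> V}" using Or(1) Vr(1) by simp
    show "x + y \<in> {a \<in> Oc. a / t ^ k \<in> V}"
      if "x \<in> {a \<in> Oc. a / t ^ k \<in> V}" "y \<in> {a \<in> Oc. a / t ^ k \<in> V}" for x y
      using that Or(3)[of x y] Vr(3)[of "x / t ^ k" "y / t ^ k"] by (simp add: add_divide_distrib)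
    show "r * x \<in> {a \<in> Oc. a / t ^ k \<in> V}"
      if "r \<in> Oc" "x \<in> {a \<in> Oc. a / t ^ k \<in> V}" for r x
      using that Or(5)[of r x] Vr(5)[of r "x / t ^ k"] OcV by auto
  qed blast
qed

text \<open>This links \<open>ord_at\<close> to the valuation. The value bound gives only
  \<open>s * a = r * t ^ k\<close> with \<open>s\<close> outside \<open>P\<close>; the factor
  \<open>s\<close> is removed by its inverse modulo the \<open>k\<close>-th power of
  \<open>P\<close>.\<close>

lemma ideal_pow_iff:
  assumes a: "a \<in> Oc" "a \<noteq> 0"
  shows "a \<in> ideal_pow Oc P k \<longleftrightarrow> int k \<le> u a"
proof
  have "ideal_pow Oc P k \<subseteq> {a \<in> Oc. a = 0 \<or> int k \<le> u a}"
  proof (induction k)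
    case 0
    then show ?case using u_Oc by auto
  next
    case (Suc k)
    show ?case
      unfolding ideal_pow.simps ideal_mult_def
    proof (rule ideal_gen_minimal[OF valuation_ideal], safe)
      fix x y assume xy: "x \<in> P" "y \<in> ideal_pow Oc P k" and n: "\<not> int (Suc k) \<le> u (x * y)"
      have y: "y \<in> Oc" "y = 0 \<or> int k \<le> u y" using Suc xy(2) by auto
      show "x * y = 0"
      proof (rule ccontr)
        assume "x * y \<noteq> 0"
        then have nz: "x \<noteq> 0" "y \<noteq> 0" by auto
        then have "u (x * y) = u x + u y" using xy(1) y(1) PI(1) OcL by (intro ur(1)) auto
        then show False using n u_P[OF xy(1) nz(1)] y(2) nz(2) by simp
      qed
    next
      fix x y assume "x \<in> P" "y \<in> ideal_pow Oc P k"
      then show "x * y \<in> Oc" using Suc PI(1) by (intro Or(5)) auto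
    qed
  qed
  then show "int k \<le> u a" if "a \<in> ideal_pow Oc P k" using that a(2) by blast
next
  assume k: "int k \<le> u a"
  note Pk = ideal_ofD[OF ideal_of_ideal_pow[OF Oc prime_ideal_ofD(1)[OF P], of k]]
  obtain t where t: "t \<in> P" "t \<noteq> 0" "u t = 1" using uniformizer by blast
  have tL: "t ^ k \<in> L" "t ^ k \<noteq> 0" "u (t ^ k) = int k"
    using t ur(6)[of t k] PI(1) OcL subring_power[OF Lf(1)] by auto
  have aL: "a \<in> L" using a(1) OcL by blast
  have "a / t ^ k \<in> V"
    using ur(2)[of "a / t ^ k"] ur(5)[OF aL tL(1) a(2) tL(2)] tL Lf(3)[OF aL tL(1)] a(2) k by simp
  then obtain r s where rs: "r \<in> Oc" "s \<in> Oc" "s \<notin> P" "a / t ^ k = r / s"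
    unfolding localization_def by blast
  have "s \<noteq> 0" by (rule not_in_prime_nonzero[OF Oc P rs(3)])
  then have sa: "s * a = r * t ^ k" using rs(4) tL(2) by (simp add: field_simps)
  have "r * t ^ k \<in> ideal_pow Oc P k"
    by (rule Pk(6)[OF rs(1) power_mem_ideal_pow[OF Oc t(1)]])
  then have "s * a \<in> ideal_pow Oc P k" by (simp add: sa)
  moreover obtain d where d: "d \<in> Oc" "1 - s * d \<in> ideal_pow Oc P k"
    using inverse_mod_ideal_pow[OF rs(2,3)] by blast
  ultimately have "a * (1 - s * d) + d * (s * a) \<in> ideal_pow Oc P k"
    using a(1) by (intro Pk(3) Pk(6)[where r = a] Pk(6)[where r = d]) auto
  also have "a * (1 - s * d) + d * (s * a) = a" by (simp add: algebra_simps)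
  finally show "a \<in> ideal_pow Oc P k" .
qed

lemma ord_at_eq:
  assumes a: "a \<in> Oc" "a \<noteq> 0"
  shows "int (ord_at Oc P a) = u a"
proof -
  have "ord_at Oc P a = nat (u a)"
    unfolding ord_at_def ideal_pow_iff[OF a] by (rule Greatest_equality) (use u_Oc[OF a] in auto)
  then show ?thesis using u_Oc[OF a] by simp
qed

lemma val_at_eq:
  assumes z: "z \<in> L" "z \<noteq> 0"
  shows "val_at Oc P z = u z"
proof -
  have *: "int (ord_at Oc P a) - int (ord_at Oc P b) = u z"
    if "a \<in> Oc" "b \<in> Oc" "a \<noteq> 0" "b \<noteq> 0" "z = a / b" for a b
  proof -
    have "a \<in> L" "b \<in> L" using that(1,2) OcL by auto
    then show ?thesis using that ur(5)[of a b] by (simp add: ord_at_eq)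
  qed
  obtain d where d: "d \<in> A - {0}" "d * z \<in> Oc" using integral_denominator[OF z(1)] by blast
  then have "\<exists>a\<in>Oc. \<exists>b\<in>Oc. a \<noteq> 0 \<and> b \<noteq> 0 \<and> z = a / b"
    using z(2) AOc by (intro bexI[of _ "d * z"] bexI[of _ d]) auto
  then show ?thesis
    unfolding val_at_def using * by (intro the_equality) (metis, metis)
qed

text \<open>\<open>x\<close> is a power of \<open>\<pi>\<close> times a unit of \<open>Ap\<close>,
  and units of \<open>Ap\<close> remain units in \<open>V\<close>.\<close>

lemma u_K:
  assumes x: "x \<in> K" "x \<noteq> 0"
  shows "u x = u \<pi> * v x"
proof -
  have unit: "u y = 0" if y: "y \<in> K" "y \<noteq> 0" "v y = 0" for y
  proof -
    have yL: "y \<in> L" using y KL by blast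
    have "y \<in> Ap" using vr(2)[OF y(1,2)] y(3) by simp
    moreover have "inverse y \<in> Ap"
      using vr(2)[of "inverse y"] vr(4)[OF y(1,2)] y Kf(2)[OF y(1)] by simp
    ultimately show ?thesis
      using ur(2)[OF yL y(2)] ur(2)[of "inverse y"] ur(4)[OF yL y(2)] Ap_V y(2) Lf(2)[OF yL] by auto
  qed
  have pow: "\<pi> ^ k \<in> K" "\<pi> ^ k \<noteq> 0" "v (\<pi> ^ k) = int k" "u (\<pi> ^ k) = int k * u \<pi>" for k
    using \<pi> \<pi>_mem vr(6)[of \<pi> k] ur(6)[of \<pi> k] subring_power[OF Kf(1)] by auto
  have xL: "x \<in> L" and powL: "\<pi> ^ k \<in> L" for k using x pow KL by auto
  show ?thesis
  proof (cases "0 \<le> v x")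
    case True
    then have "u (x / \<pi> ^ nat (v x)) = 0"
      using vr(5)[OF x(1) pow(1) x(2) pow(2)] pow x Kf(3) by (intro unit) auto
    then show ?thesis using ur(5)[OF xL powL x(2) pow(2)] pow(4) True by (simp add: mult.commute)
  next
    case False
    then have "u (x * \<pi> ^ nat (- v x)) = 0"
      using vr(1)[OF x(1) pow(1) x(2) pow(2)] pow x Kr(5) by (intro unit) auto
    then show ?thesis using ur(1)[OF xL powL x(2) pow(2)] pow(4) False by (simp add: mult.commute)
  qed
qed

lemma u_\<pi>_pos: "0 < u \<pi>"
  using u_P[of \<pi>] \<pi> PA by force

text \<open>Nonzero elements of \<open>p\<close> have \<open>v\<close> at least 1, so by
  \<open>u_K\<close> their least \<open>u\<close> is attained at \<open>\<pi>\<close>.\<close>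

lemma ram_index_eq: "int (ram_index Oc P p) = u \<pi>"
proof -
  have ord: "int (ord_at Oc P a) = u a" if "a \<in> p" "a \<noteq> 0" for a
    using ord_at_eq[of a] that pA AOc by blast
  have "ram_index Oc P p = nat (u \<pi>)"
    unfolding ram_index_def
  proof (rule Least_equality)
    show "\<exists>a\<in>p. a \<noteq> 0 \<and> ord_at Oc P a = nat (u \<pi>)"
      using ord[OF \<pi>(1,2)] \<pi> by (intro bexI[of _ \<pi>]) auto
    fix k assume "\<exists>a\<in>p. a \<noteq> 0 \<and> ord_at Oc P a = k"
    then obtain a where a: "a \<in> p" "a \<noteq> 0" "ord_at Oc P a = k" by blast
    have aK: "a \<in> K" using a(1) pA AK by blast
    have "inverse a \<notin> Ap" by (rule inverse_prime_not_in_localization[OF A p a(1,2)])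
    then have "1 \<le> v a" using vr(2)[of "inverse a"] vr(4)[OF aK a(2)] Kf(2)[OF aK] a(2) by simp
    then have "u \<pi> \<le> u a" using u_K[OF aK a(2)] u_\<pi>_pos by simp
    then show "nat (u \<pi>) \<le> k" using ord[OF a(1,2)] a(3) by simp
  qed
  then show ?thesis using u_\<pi>_pos by simp
qed

end

subsection \<open>The primes over \<open>p\<close> and the map \<open>wS\<close>\<close>

lemma prime_ideal_prod:
  assumes R: "subring R" and P: "prime_ideal_of R P" and "finite I"
    and "\<And>i. i \<in> I \<Longrightarrow> y i \<in> R" "\<And>i. i \<in> I \<Longrightarrow> y i \<notin> P"
  shows "prod y I \<notin> P"
  using assms(3-)
proof (induction I rule: finite_induct)
  case empty
  then show ?case using prime_ideal_ofD(3)[OF P] by simp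
next
  case (insert i I)
  then have "prod y I \<in> R" "prod y I \<notin> P" by (auto intro: subring_prod[OF R])
  then show ?case using mult_not_in_prime[OF R P, of "y i" "prod y I"] insert by simp
qed

context dedekind_ext
begin

lemma prime_over_I: "P \<in> primes_over A p Oc \<Longrightarrow> prime_over A p K L Oc n v \<pi> P"
  by (intro prime_over.intro dedekind_ext_axioms prime_over_axioms.intro)

text \<open>Elements \<open>x i\<close> lying in all but one of \<open>n + 1\<close> primes would be linearly independent over \<open>K\<close>.\<close>

lemma finite_primes_over: "finite (primes_over A p Oc)"
proof (rule ccontr)
  assume "infinite (primes_over A p Oc)"
  then obtain S where S: "finite S" "card S = Suc n" "S \<subseteq> primes_over A p Oc"
    using infinite_arbitrarily_large by blast
  obtain h where h: "bij_betw h {0..<Suc n} S"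
    using ex_bij_betw_nat_finite[OF S(1)] S(2) by auto
  have P: "prime_over A p K L Oc n v \<pi> Q" if "Q \<in> S" for Q
    using prime_over_I S(3) that by blast
  have primeS: "prime_ideal_of Oc Q" if "Q \<in> S" for Q using prime_over.P[OF P[OF that]] .
  \<comment> \<open>Distinct primes over \<open>p\<close> are incomparable, so the product of the
    chosen \<open>y Q R\<close> lies in every prime of \<open>S\<close> except
    \<open>Q\<close>.\<close>
  have "\<exists>y. y \<in> R - Q" if "Q \<in> S" "R \<in> S" "R \<noteq> Q" for Q R
    using prime_over.P_eq_if_subset[OF P[OF that(2)] P[OF that(1)]] that(3) by blast
  then obtain y where y: "\<And>Q R. Q \<in> S \<Longrightarrow> R \<in> S \<Longrightarrow> R \<noteq> Q \<Longrightarrow> y Q R \<in> R - Q" by metis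
  define x where "x Q = (\<Prod>R\<in>S - {Q}. y Q R)" for Q
  have yO: "y Q R \<in> Oc" if "Q \<in> S" "R \<in> S - {Q}" for Q R
    using y[of Q R] prime_ideal_ofD(2)[OF primeS[of R]] that by blast
  have xO: "x Q \<in> Oc" if "Q \<in> S" for Q
    unfolding x_def using yO[OF that] by (rule subring_prod[OF Oc])
  have x_notin: "x Q \<notin> Q" if "Q \<in> S" for Q
    unfolding x_def using S(1) yO[OF that] y[OF that] by (intro prime_ideal_prod[OF Oc primeS[OF that]]) auto
  have x_in: "x Q \<in> R" if "Q \<in> S" "R \<in> S" "R \<noteq> Q" for Q R
  proof -
    have "x Q = y Q R * (\<Prod>T\<in>S - {Q} - {R}. y Q T)"
      unfolding x_def using S(1) that by (intro prod.remove) auto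
    moreover have "(\<Prod>T\<in>S - {Q} - {R}. y Q T) \<in> Oc"
      using yO[OF that(1)] by (intro subring_prod[OF Oc]) auto
    ultimately show ?thesis
      using ideal_ofD(7)[OF prime_ideal_ofD(1)[OF primeS[OF that(2)]]] y[OF that] by auto
  qed
  have hS: "h j \<in> S" if "j \<in> {..n}" for j
    using h that by (auto simp: bij_betw_def)
  have h_inj: "h j \<noteq> h k" if "j \<in> {..n}" "k \<in> {..n}" "j \<noteq> k" for j k
    using h that by (auto simp: bij_betw_def inj_on_def)
  have "lin_dep K {..n} (\<lambda>j. x (h j))"
    using xO hS OcL by (intro dep) auto
  then obtain c k where c: "\<forall>j\<in>{..n}. c j \<in> A" "k \<in> {..n}" "c k \<notin> p" "(\<Sum>j\<in>{..n}. c j * x (h j)) = 0"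
    using lin_dep_normalized_A[of "{..n}" "\<lambda>j. x (h j)"] by blast
  interpret Q: prime_over A p K L Oc n v \<pi> "h k" by (rule P[OF hS[OF c(2)]])
  have mod: "submodule Oc (h k)" using Q.PI(2,3,6) by (auto simp: submodule_def)
  \<comment> \<open>Modulo the prime \<open>h k\<close> only the term of index \<open>k\<close>
    survives, and it is a product of two elements outside that prime.\<close>
  have "(\<Sum>j\<in>{..n} - {k}. c j * x (h j)) \<in> h k"
  proof (rule submodule_sum[OF mod])
    fix j assume j: "j \<in> {..n} - {k}"
    have "x (h j) \<in> h k" using x_in[of "h j" "h k"] hS[of j] hS[of k] h_inj[of k j] c(2) j by auto
    moreover have "c j \<in> Oc" using c(1) j AOc by blast
    ultimately show "c j * x (h j) \<in> h k" using Q.PI(6) by blast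
  qed
  moreover have "c k * x (h k) = - (\<Sum>j\<in>{..n} - {k}. c j * x (h j))"
    using c(4) sum.remove[of "{..n}" k "\<lambda>j. c j * x (h j)"] c(2) by (simp add: add_eq_0_iff2)
  ultimately have "c k * x (h k) \<in> h k" using Q.PI(4) by simp
  moreover have "c k \<in> Oc" "c k \<notin> h k" using c(1-3) AOc Q.PA by auto
  ultimately show False
    using prime_ideal_ofD(4)[OF Q.P _ xO[OF hS[OF c(2)]]] x_notin[OF hS[OF c(2)]] by blast
qed

section \<open>Integrality at \<open>p\<close> tested at the primes over \<open>p\<close>\<close>

abbreviation "Op \<equiv> integral_closure Ap L"

lemma Op: "subring Op" by (rule subring_integral_closure[OF Ap Lf(1)])
lemmas Opr = subringD[OF Op]

lemma Ap_Op: "Ap \<subseteq> Op"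
  using integral_over_base[OF Ap] ApK KL by (auto simp: integral_closure_iff)

lemma Ap_Op_mult: "a \<in> Ap \<Longrightarrow> z \<in> Op \<Longrightarrow> a * z \<in> Op"
  using Ap_Op by (intro Opr(5)) auto

text \<open>The conductor of \<open>z\<close> in \<open>Oc\<close> misses \<open>A - p\<close>. An
  ideal maximal among those containing it and missing this multiplicative set is prime, contracts to
  \<open>p\<close>, and still contains every denominator of \<open>z\<close>.\<close>

lemma not_integral_imp_prime_over:
  assumes z: "z \<in> L" "z \<notin> Op"
  shows "\<exists>P\<in>primes_over A p Oc. z \<notin> localization Oc P"
proof -
  define I where "I = {b \<in> Oc. b * z \<in> Oc}"
  have I: "ideal_of Oc I"
  proof (rule ideal_ofI[OF Oc])
    show "I \<subseteq> Oc" "0 \<in> I" using Or(1) by (auto simp: I_def)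
    show "x + y \<in> I" if "x \<in> I" "y \<in> I" for x y
      using that Or(3)[of x y] Or(3)[of "x * z" "y * z"] by (simp add: I_def distrib_right)
    show "r * x \<in> I" if "r \<in> Oc" "x \<in> I" for r x
      using that Or(5)[of r x] Or(5)[of r "x * z"] by (simp add: I_def mult.assoc)
  qed
  have disj: "I \<inter> (A - p) = {}"
  proof (rule ccontr)
    assume "\<not> ?thesis"
    then obtain s where s: "s \<in> A" "s \<notin> p" "s * z \<in> Oc" by (auto simp: I_def)
    have "s * z \<in> Op" using s(3) integral_over_mono[OF A_Ap] by (auto simp: Oc_eq integral_closure_iff)
    then have "inverse s * (s * z) \<in> Op" by (rule Ap_Op_mult[OF localization_inverse[OF A p s(1,2)]])
    then show False using z(2) not_in_prime_nonzero[OF A p s(2)] by (simp flip: mult.assoc)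
  qed
  define \<I> where "\<I> = {J. ideal_of Oc J \<and> I \<subseteq> J \<and> J \<inter> (A - p) = {}}"
  have "\<exists>M\<in>\<I>. \<forall>J\<in>\<I>. M \<subseteq> J \<longrightarrow> J = M"
  proof (rule subset_Zorn_nonempty)
    show "\<I> \<noteq> {}" using I disj by (auto simp: \<I>_def)
    fix C assume C: "C \<noteq> {}" "subset.chain \<I> C"
    have "ideal_of Oc (\<Union>C)" by (rule ideal_of_Union_chain[OF Oc C]) (simp add: \<I>_def)
    moreover have C\<I>: "I \<subseteq> J" "J \<inter> (A - p) = {}" if "J \<in> C" for J
      using C(2) that by (auto simp: subset.chain_def \<I>_def)
    moreover obtain J where "J \<in> C" using C(1) by blast
    ultimately show "\<Union>C \<in> \<I>" unfolding \<I>_def by (simp add: Union_disjoint Sup_upper2)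
  qed
  then obtain M where "M \<in> \<I>" and Mmax: "\<And>J. J \<in> \<I> \<Longrightarrow> M \<subseteq> J \<Longrightarrow> J = M" by blast
  then have M: "ideal_of Oc M" "I \<subseteq> M" "M \<inter> (A - p) = {}" by (simp_all add: \<I>_def)
  note Mr = ideal_ofD[OF M(1)]
  have one: "1 \<in> A - p" using subringD(2)[OF A] prime_ideal_ofD(3)[OF p] by simp
  \<comment> \<open>By maximality, enlarging \<open>M\<close> by any new element produces an element
    of \<open>A - p\<close>.\<close>
  have meets: "\<exists>i r. i \<in> M \<and> r \<in> Oc \<and> i + r * a \<in> A - p" if a: "a \<in> Oc" "a \<notin> M" for a
  proof (rule ccontr)
    assume contra: "\<not> ?thesis"
    note J = ideal_plus_principal[OF Oc M(1) a(1)]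
    have "{i + r * a | i r. i \<in> M \<and> r \<in> Oc} \<inter> (A - p) = {}" using contra by auto
    then have "{i + r * a | i r. i \<in> M \<and> r \<in> Oc} \<in> \<I>"
      using J(1) subset_trans[OF M(2) J(2)] by (simp only: \<I>_def mem_Collect_eq simp_thms)
    then have "{i + r * a | i r. i \<in> M \<and> r \<in> Oc} = M" by (rule Mmax[OF _ J(2)])
    then show False using J(3) a(2) by simp
  qed
  have prime: "prime_ideal_of Oc M"
    unfolding prime_ideal_of_def
  proof (intro conjI ballI impI)
    show "M \<noteq> Oc" using one M(3) Or(2) by blast
    fix a b assume ab: "a \<in> Oc" "b \<in> Oc" "a * b \<in> M"
    show "a \<in> M \<or> b \<in> M"
    proof (rule ccontr)
      assume "\<not> ?thesis"
      then obtain i r j s where ij: "i \<in> M" "r \<in> Oc" "i + r * a \<in> A - p" "j \<in> M" "s \<in> Oc" "j + s * b \<in> A - p"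
        using meets[OF ab(1)] meets[OF ab(2)] by blast
      have "(i + r * a) * (j + s * b) \<in> A - p"
        using ij(3,6) mult_not_in_prime[OF A p, of "i + r * a" "j + s * b"]
          subringD(5)[OF A, of "i + r * a" "j + s * b"] by blast
      moreover have "(i + r * a) * (j + s * b) \<in> M"
      proof -
        have "j + s * b \<in> Oc" by (rule Or(3)[OF subsetD[OF Mr(1) ij(4)] Or(5)[OF ij(5) ab(2)]])
        then have "i * (j + s * b) \<in> M" by (rule Mr(7)[OF _ ij(1)])
        moreover have "(r * a) * j \<in> M" by (rule Mr(6)[OF Or(5)[OF ij(2) ab(1)] ij(4)])
        moreover have "(r * s) * (a * b) \<in> M" by (rule Mr(6)[OF Or(5)[OF ij(2,5)] ab(3)])
        ultimately have "i * (j + s * b) + (r * a) * j + (r * s) * (a * b) \<in> M" by (intro Mr(3))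
        then show ?thesis by (simp add: algebra_simps)
      qed
      ultimately show False using M(3) by blast
    qed
  qed (rule M(1))
  have "prime_ideal_of A (M \<inter> A)"
    unfolding prime_ideal_of_def
  proof (intro conjI ballI impI)
    show "ideal_of A (M \<inter> A)"
    proof (rule ideal_ofI[OF A])
      show "0 \<in> M \<inter> A" using Mr(2) subringD(1)[OF A] by blast
      show "x + y \<in> M \<inter> A" if "x \<in> M \<inter> A" "y \<in> M \<inter> A" for x y
        using that Mr(3)[of x y] subringD(3)[OF A, of x y] by blast
      show "r * x \<in> M \<inter> A" if "r \<in> A" "x \<in> M \<inter> A" for r x
        using that Mr(6)[of r x] subringD(5)[OF A, of r x] AOc by blast
    qed blast
    show "M \<inter> A \<noteq> A" using one M(3) by blast
    show "a \<in> M \<inter> A \<or> b \<in> M \<inter> A" if "a \<in> A" "b \<in> A" "a * b \<in> M \<inter> A" for a b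
      using prime_ideal_ofD(4)[OF prime, of a b] that AOc by blast
  qed
  \<comment> \<open>A denominator \<open>d\<close> of \<open>z\<close> in \<open>A\<close> makes the
    contraction nonzero, hence maximal by dimension one; being contained in \<open>p\<close>, it
    equals \<open>p\<close>.\<close>
  moreover obtain d where d: "d \<in> A - {0}" "d * z \<in> Oc" using integral_denominator[OF z(1)] by blast
  then have dM: "d \<in> M \<inter> A" using M(2) AOc by (auto simp: I_def)
  ultimately have "maximal_ideal_of A (M \<inter> A)" using d(1) by (intro dim1) auto
  moreover have "M \<inter> A \<subseteq> p" using M(3) by blast
  ultimately have "M \<inter> A = p" using p unfolding maximal_ideal_of_def prime_ideal_of_def by blast
  then have "M \<in> primes_over A p Oc" using prime dM d(1) by (auto simp: primes_over_def)
  moreover have "z \<notin> localization Oc M"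
  proof
    assume "z \<in> localization Oc M"
    then obtain s where "s \<in> Oc - M" "s * z \<in> Oc" using localization_clear[OF Oc prime] by blast
    then show False using M(2) by (auto simp: I_def)
  qed
  ultimately show ?thesis by blast
qed

lemma inverse_\<pi>_not_integral: "inverse \<pi> \<notin> Op"
  using Ap_closed[of "inverse \<pi>"] v_inverse_\<pi> Kf(2) \<pi>_mem(2) by (auto simp: integral_closure_iff)

text \<open>The non-integral element \<open>inverse \<pi>\<close> must fail at some prime. The
  minimum in \<open>wS\<close> is therefore taken over a nonempty set.\<close>

lemma primes_over_nonempty: "primes_over A p Oc \<noteq> {}"
  using not_integral_imp_prime_over[OF _ inverse_\<pi>_not_integral] Lf(2) \<pi>_mem(3) by blast

definition W :: "'a \<Rightarrow> real" where
  "W z = Min ((\<lambda>P. real_of_int (val_at Oc P z) / real (ram_index Oc P p)) ` primes_over A p Oc)"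

lemma wS_eq: "wS A p Oc z = (if z = 0 then \<infinity> else ereal (W z))"
  by (simp add: wS_def W_def)

text \<open>At each prime, \<open>u\<close> grows by \<open>u \<pi> * v x\<close>; division by the
  ramification index \<open>u \<pi>\<close> makes the shift the same everywhere, so it passes
  through the minimum.\<close>

lemma W_scale:
  assumes x: "x \<in> K" "x \<noteq> 0" and z: "z \<in> L" "z \<noteq> 0"
  shows "W (x * z) = v x + W z"
proof -
  have xL: "x \<in> L" using x KL by blast
  have "real_of_int (val_at Oc P (x * z)) / real (ram_index Oc P p)
      = real_of_int (val_at Oc P z) / real (ram_index Oc P p) + real_of_int (v x)"
    if P: "P \<in> primes_over A p Oc" for P
  proof -
    interpret prime_over A p K L Oc n v \<pi> P by (rule prime_over_I[OF P])
    have "val_at Oc P (x * z) = u \<pi> * v x + u z"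
      using val_at_eq[of "x * z"] Lr(5)[OF xL z(1)] ur(1)[OF xL z(1) x(2) z(2)] u_K[OF x] x(2) z(2) by simp
    moreover have "val_at Oc P z = u z" by (rule val_at_eq[OF z])
    moreover have "real (ram_index Oc P p) = real_of_int (u \<pi>)"
      using arg_cong[OF ram_index_eq, of real_of_int] by simp
    ultimately show ?thesis using u_\<pi>_pos by (simp add: field_simps)
  qed
  then have "W (x * z) = Min ((\<lambda>P. real_of_int (val_at Oc P z) / real (ram_index Oc P p) + real_of_int (v x)) ` primes_over A p Oc)"
    unfolding W_def by (intro arg_cong[of _ _ Min] image_cong) auto
  also have "\<dots> = W z + real_of_int (v x)"
    unfolding W_def by (rule Min_add_commute[OF finite_primes_over primes_over_nonempty])
  finally show ?thesis by simp
qed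

text \<open>\<open>Op\<close> is the intersection of the localizations of \<open>Oc\<close> at the
  primes over \<open>p\<close>.\<close>

lemma W_nonneg_iff:
  assumes z: "z \<in> L" "z \<noteq> 0"
  shows "0 \<le> W z \<longleftrightarrow> z \<in> Op"
proof -
  have *: "0 \<le> real_of_int (val_at Oc P z) / real (ram_index Oc P p) \<longleftrightarrow> z \<in> localization Oc P"
    if P: "P \<in> primes_over A p Oc" for P
  proof -
    interpret prime_over A p K L Oc n v \<pi> P by (rule prime_over_I[OF P])
    have "real (ram_index Oc P p) = real_of_int (u \<pi>)"
      using arg_cong[OF ram_index_eq, of real_of_int] by simp
    then show ?thesis
      using val_at_eq[OF z] ur(2)[OF z] u_\<pi>_pos by (simp add: zero_le_divide_iff)
  qed
  have "0 \<le> W z \<longleftrightarrow> (\<forall>P\<in>primes_over A p Oc. z \<in> localization Oc P)"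
    unfolding W_def using finite_primes_over primes_over_nonempty * by simp
  also have "\<dots> \<longleftrightarrow> z \<in> Op"
  proof
    assume Op: "z \<in> Op"
    show "\<forall>P\<in>primes_over A p Oc. z \<in> localization Oc P"
    proof
      fix P assume P: "P \<in> primes_over A p Oc"
      interpret prime_over A p K L Oc n v \<pi> P by (rule prime_over_I[OF P])
      show "z \<in> localization Oc P"
        using V_integrally_closed[OF z(1)] integral_over_mono[OF Ap_V] Op by (simp add: integral_closure_iff)
    qed
  qed (use not_integral_imp_prime_over[OF z(1)] in blast)
  finally show ?thesis .
qed

lemma v_powi_\<pi>: "\<pi> powi k \<in> K" "\<pi> powi k \<noteq> 0" "v (\<pi> powi k) = k"
proof -
  show 0: "\<pi> powi k \<noteq> 0" using \<pi>(2) by simp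
  have pow: "\<pi> ^ j \<in> K" "v (\<pi> ^ j) = int j" for j
    using vr(6)[of \<pi> j] \<pi> \<pi>_mem(2) subring_power[OF Kf(1)] by auto
  show "\<pi> powi k \<in> K" using pow(1) Kf(2) by (simp add: power_int_def power_inverse)
  show "v (\<pi> powi k) = k"
  proof (cases "0 \<le> k")
    case True
    then show ?thesis using pow by (simp add: power_int_def)
  next
    case False
    then show ?thesis using vr(4)[OF pow(1)[of "nat (- k)"]] pow(2) \<pi>(2) by (simp add: power_int_def power_inverse)
  qed
qed

text \<open>An integer bounds a floor from below exactly when it bounds the number itself, and the
  factor \<open>\<pi> powi (- k)\<close> moves the bound to 0.\<close>

lemma efloor_wS_ge_iff:
  assumes z: "z \<in> L"
  shows "ereal (of_int k) \<le> efloor (wS A p Oc z) \<longleftrightarrow> \<pi> powi (- k) * z \<in> Op"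
proof (cases "z = 0")
  case True
  then show ?thesis using Opr(1) by (simp add: wS_eq efloor_def)
next
  case False
  have "\<pi> powi (- k) * z \<in> Op \<longleftrightarrow> 0 \<le> W (\<pi> powi (- k) * z)"
    using False v_powi_\<pi>[of "- k"] z KL Lr(5) by (intro W_nonneg_iff[symmetric]) auto
  also have "\<dots> \<longleftrightarrow> k \<le> \<lfloor>W z\<rfloor>"
    using W_scale[OF v_powi_\<pi>(1,2) z False, of "- k"] v_powi_\<pi>(3)[of "- k"] by (simp add: le_floor_iff)
  finally show ?thesis using False by (simp add: wS_eq efloor_def)
qed

end

section \<open>Semi-orthonormality in terms of integrality\<close>

lemma ereal_eq_if_same_integer_lower_bounds:
  assumes x: "x = \<infinity> \<or> (\<exists>i::int. x = ereal (of_int i))" and y: "y = \<infinity> \<or> (\<exists>i::int. y = ereal (of_int i))"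
    and same: "\<And>k::int. ereal (of_int k) \<le> x \<longleftrightarrow> ereal (of_int k) \<le> y"
  shows "x = y"
proof -
  have le: "x \<le> y" if x: "x = \<infinity> \<or> (\<exists>i::int. x = ereal (of_int i))" and y: "y = \<infinity> \<or> (\<exists>i::int. y = ereal (of_int i))"
    and same: "\<And>k::int. ereal (of_int k) \<le> x \<Longrightarrow> ereal (of_int k) \<le> y" for x y
  proof (cases "y = \<infinity>")
    case False
    then obtain j :: int where j: "y = ereal (of_int j)" using y by blast
    \<comment> \<open>The test integer \<open>j + 1\<close> lies below \<infinity> but not below
      \<open>y\<close>.\<close>
    have "x \<noteq> \<infinity>" using same[of "j + 1"] j by auto
    then show ?thesis using x same by auto
  qed simp
  show ?thesis using le[OF x y] le[OF y x] same by (simp add: antisym)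
qed

context dedekind_ext
begin

lemma efloor_wS_cases: "efloor (wS A p Oc z) = \<infinity> \<or> (\<exists>i::int. efloor (wS A p Oc z) = ereal (of_int i))"
  by (auto simp: wS_eq efloor_def)

text \<open>Equality of the two floors is one equivalence for each integer threshold
  \<open>k\<close>. As the coefficients range over all of \<open>K\<close>, they absorb
  \<open>\<pi> powi (- k)\<close>, and only the threshold 0 remains.\<close>

lemma semi_reduced_iff:
  assumes n: "n > 0" and b: "\<forall>i<n. b i \<in> L"
  shows "semi_reduced A p Oc K n b \<longleftrightarrow>
    (\<forall>c. (\<forall>i<n. c i \<in> K) \<longrightarrow> ((\<Sum>i<n. c i * b i) \<in> Op \<longleftrightarrow> (\<forall>i<n. c i * b i \<in> Op)))"
    (is "_ \<longleftrightarrow> (\<forall>c. ?K c \<longrightarrow> ?S c)")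
proof -
  define E where "E z = efloor (wS A p Oc z)" for z
  have cb: "c i * b i \<in> L" if "?K c" "i < n" for c i
    using that b KL by (intro Lr(5)) auto
  have sum: "(\<Sum>i<n. c i * b i) \<in> L" if "?K c" for c
    using cb[OF that] by (intro subring_sum[OF Lf(1)]) auto
  have Min: "Min ((\<lambda>i. E (c i * b i)) ` {..<n}) = \<infinity> \<or> (\<exists>j::int. Min ((\<lambda>i. E (c i * b i)) ` {..<n}) = ereal (of_int j))" for c
  proof -
    have "Min ((\<lambda>i. E (c i * b i)) ` {..<n}) \<in> (\<lambda>i. E (c i * b i)) ` {..<n}"
      using n by (intro Min_in) auto
    then obtain i where "Min ((\<lambda>i. E (c i * b i)) ` {..<n}) = E (c i * b i)" by blast
    then show ?thesis using efloor_wS_cases[of "c i * b i"] by (simp only: E_def)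
  qed
  have ge_Min: "ereal (of_int k) \<le> Min ((\<lambda>i. E (c i * b i)) ` {..<n}) \<longleftrightarrow> (\<forall>i<n. \<pi> powi (- k) * (c i * b i) \<in> Op)"
    if "?K c" for c k
    using n efloor_wS_ge_iff[OF cb[OF that]] by (subst Min_ge_iff) (auto simp: E_def)
  have ge_sum: "ereal (of_int k) \<le> E (\<Sum>i<n. c i * b i) \<longleftrightarrow> \<pi> powi (- k) * (\<Sum>i<n. c i * b i) \<in> Op"
    if "?K c" for c k
    unfolding E_def by (rule efloor_wS_ge_iff[OF sum[OF that]])
  have key: "E (\<Sum>i<n. c i * b i) = Min ((\<lambda>i. E (c i * b i)) ` {..<n}) \<longleftrightarrow>
      (\<forall>k. \<pi> powi (- k) * (\<Sum>i<n. c i * b i) \<in> Op \<longleftrightarrow> (\<forall>i<n. \<pi> powi (- k) * (c i * b i) \<in> Op))"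
    if c: "?K c" for c
  proof
    assume same: "\<forall>k. \<pi> powi (- k) * (\<Sum>i<n. c i * b i) \<in> Op \<longleftrightarrow> (\<forall>i<n. \<pi> powi (- k) * (c i * b i) \<in> Op)"
    show "E (\<Sum>i<n. c i * b i) = Min ((\<lambda>i. E (c i * b i)) ` {..<n})"
    proof (rule ereal_eq_if_same_integer_lower_bounds[OF _ Min])
      show "E (\<Sum>i<n. c i * b i) = \<infinity> \<or> (\<exists>j::int. E (\<Sum>i<n. c i * b i) = ereal (of_int j))"
        unfolding E_def by (rule efloor_wS_cases)
      show "ereal (of_int k) \<le> E (\<Sum>i<n. c i * b i) \<longleftrightarrow> ereal (of_int k) \<le> Min ((\<lambda>i. E (c i * b i)) ` {..<n})" for k :: int
        unfolding ge_sum[OF c] ge_Min[OF c] using same by blast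
    qed
  next
    assume eq: "E (\<Sum>i<n. c i * b i) = Min ((\<lambda>i. E (c i * b i)) ` {..<n})"
    show "\<forall>k. \<pi> powi (- k) * (\<Sum>i<n. c i * b i) \<in> Op \<longleftrightarrow> (\<forall>i<n. \<pi> powi (- k) * (c i * b i) \<in> Op)"
    proof
      fix k
      show "\<pi> powi (- k) * (\<Sum>i<n. c i * b i) \<in> Op \<longleftrightarrow> (\<forall>i<n. \<pi> powi (- k) * (c i * b i) \<in> Op)"
        using ge_sum[OF c, of k] ge_Min[OF c, of k] unfolding eq by blast
    qed
  qed
  have eq: "semi_reduced A p Oc K n b \<longleftrightarrow> (\<forall>c. ?K c \<longrightarrow>
      (\<forall>k. \<pi> powi (- k) * (\<Sum>i<n. c i * b i) \<in> Op \<longleftrightarrow> (\<forall>i<n. \<pi> powi (- k) * (c i * b i) \<in> Op)))"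
    unfolding semi_reduced_def E_def[symmetric] by (rule iff_allI, rule imp_cong[OF refl], erule key)
  show ?thesis
    unfolding eq
  proof (rule iffI; intro allI impI)
    fix c assume 1: "\<forall>c. ?K c \<longrightarrow> (\<forall>k. \<pi> powi (- k) * (\<Sum>i<n. c i * b i) \<in> Op \<longleftrightarrow> (\<forall>i<n. \<pi> powi (- k) * (c i * b i) \<in> Op))"
      and c: "?K c"
    have "\<pi> powi (- 0) * (\<Sum>i<n. c i * b i) \<in> Op \<longleftrightarrow> (\<forall>i<n. \<pi> powi (- 0) * (c i * b i) \<in> Op)"
      by (rule spec[OF mp[OF spec[OF 1] c]])
    then show "?S c" by (simp only: minus_zero power_int_0_right mult_1)
  next
    fix c k assume 1: "\<forall>c. ?K c \<longrightarrow> ?S c" and c: "?K c"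
    have "?K (\<lambda>i. \<pi> powi (- k) * c i)" using c by (simp add: Kr(5)[OF v_powi_\<pi>(1)])
    then have "?S (\<lambda>i. \<pi> powi (- k) * c i)" by (rule mp[OF spec[OF 1]])
    then show "\<pi> powi (- k) * (\<Sum>i<n. c i * b i) \<in> Op \<longleftrightarrow> (\<forall>i<n. \<pi> powi (- k) * (c i * b i) \<in> Op)"
      by (simp only: sum_distrib_left mult.assoc)
  qed
qed

lemma wS_unit_interval_iff:
  assumes z: "z \<in> L"
  shows "0 \<le> wS A p Oc z \<and> wS A p Oc z < 1 \<longleftrightarrow> z \<in> Op \<and> inverse \<pi> * z \<notin> Op"
proof (cases "z = 0")
  \<comment> \<open>Both sides fail for 0: its \<open>wS\<close> is \<infinity>, and
    \<open>inverse \<pi> * 0\<close> is integral.\<close>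
  case True
  then show ?thesis using Opr(1) by (simp add: wS_eq)
next
  case False
  have "W (inverse \<pi> * z) = W z - 1"
    using W_scale[OF Kf(2)[OF \<pi>_mem(2)] _ z False] vr(4)[OF \<pi>_mem(2) \<pi>(2)] \<pi>(2,3) by simp
  moreover have "inverse \<pi> * z \<in> L" using Lr(5)[OF Lf(2)[OF \<pi>_mem(3)] z] .
  ultimately show ?thesis
    using W_nonneg_iff[OF z False] W_nonneg_iff[of "inverse \<pi> * z"] False \<pi>(2)
    by (auto simp: wS_eq zero_ereal_def one_ereal_def)
qed

lemma semi_orthonormal_iff:
  assumes "n > 0" and "\<forall>i<n. b i \<in> L"
  shows "semi_orthonormal A p Oc K n b \<longleftrightarrow>
    (\<forall>c. (\<forall>i<n. c i \<in> K) \<longrightarrow> ((\<Sum>i<n. c i * b i) \<in> Op \<longleftrightarrow> (\<forall>i<n. c i * b i \<in> Op))) \<and>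
    (\<forall>i<n. b i \<in> Op \<and> inverse \<pi> * b i \<notin> Op)"
  unfolding semi_orthonormal_def semi_reduced_iff[OF assms] using wS_unit_interval_iff assms(2) by blast

section \<open>Bases of \<open>Op\<close> and semi-orthonormal families\<close>

lemma not_in_Ap_multiple:
  assumes "x \<in> K" "x \<noteq> 0"
  shows "\<exists>y\<in>K. y * x \<notin> Ap"
proof -
  \<comment> \<open>The exponent gives \<open>y * x\<close> the value -1.\<close>
  define y where "y = \<pi> powi (- v x - 1)"
  have y: "y \<in> K" "y \<noteq> 0" "v y = - v x - 1" unfolding y_def by (rule v_powi_\<pi>)+
  have "v (y * x) = - 1" using vr(1)[OF y(1) assms(1) y(2) assms(2)] y(3) by simp
  then have "y * x \<notin> Ap" using vr(2)[of "y * x"] Kr(5)[OF y(1) assms(1)] y(2) assms(2) by simp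
  then show ?thesis using y(1) by blast
qed

theorem is_basis_iff_semi_orthonormal:
  assumes n: "n > 0" and b: "\<forall>i<n. b i \<in> L"
  shows "is_basis Ap Op n b \<longleftrightarrow> semi_orthonormal A p Oc K n b"
proof
  assume basis: "is_basis Ap Op n b"
  have bOp: "b i \<in> Op" if "i < n" for i using basis that by (simp add: is_basis_def)
  \<comment> \<open>A relation over \<open>K\<close> can be normalized to one over \<open>Ap\<close>
    with a coefficient 1, contradicting independence over \<open>Ap\<close>.\<close>
  have indep: "\<not> lin_dep K {..<n} b"
  proof
    assume "lin_dep K {..<n} b"
    then obtain c k where c: "\<forall>j\<in>{..<n}. c j \<in> Ap" "k \<in> {..<n}" "c k = 1" "(\<Sum>j<n. c j * b j) = 0"
      using lin_dep_normalized[of "{..<n}" b] by blast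
    then have "c k = 0" using basis by (auto simp: is_basis_def)
    then show False using c(3) by simp
  qed
  have coeffs: "c i \<in> Ap" if c: "\<forall>i<n. c i \<in> K" "(\<Sum>i<n. c i * b i) \<in> Op" and i: "i < n" for c i
  proof -
    obtain d where d: "\<forall>i<n. d i \<in> Ap" "(\<Sum>i<n. c i * b i) = (\<Sum>i<n. d i * b i)"
      using basis c(2) unfolding is_basis_def by blast
    have "(\<Sum>j<n. (c j - d j) * b j) = 0" using d(2) by (simp add: left_diff_distrib sum_subtractf)
    moreover have "\<forall>j\<in>{..<n}. c j - d j \<in> K" using c(1) d(1) ApK Kr(4) by blast
    ultimately have "\<not> (\<exists>j\<in>{..<n}. c j - d j \<noteq> 0)"
      using indep unfolding lin_dep_def by (auto dest!: spec[of _ "\<lambda>j. c j - d j"])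
    then show ?thesis using d(1) i by auto
  qed
  show "semi_orthonormal A p Oc K n b"
    unfolding semi_orthonormal_iff[OF n b]
  proof (intro conjI allI impI iffI)
    fix c i assume c: "\<forall>i<n. c i \<in> K" "(\<Sum>i<n. c i * b i) \<in> Op" and i: "i < n"
    show "c i * b i \<in> Op" by (rule Ap_Op_mult[OF coeffs[OF c i] bOp[OF i]])
  next
    fix c assume "\<forall>i<n. c i * b i \<in> Op"
    then show "(\<Sum>i<n. c i * b i) \<in> Op" by (intro subring_sum[OF Op]) auto
  next
    fix i assume i: "i < n"
    show "b i \<in> Op" by (rule bOp[OF i])
    show "inverse \<pi> * b i \<notin> Op"
    proof
      assume Op: "inverse \<pi> * b i \<in> Op"
      \<comment> \<open>As a combination with coefficients in \<open>K\<close>,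
        \<open>inverse \<pi> * b i\<close> has the single coefficient \<open>inverse \<pi>\<close>,
        which is not in \<open>Ap\<close>.\<close>
      define c where "c j = (if j = i then inverse \<pi> else 0)" for j
      have "(\<Sum>j<n. c j * b j) = inverse \<pi> * b i"
        using i by (simp add: c_def if_distrib[of "\<lambda>u. u * _"] cong: if_cong)
      moreover have "\<forall>j<n. c j \<in> K" using Kf(2)[OF \<pi>_mem(2)] Kr(1) by (simp add: c_def)
      ultimately have "c i \<in> Ap" using coeffs[of c i] Op i by simp
      then show False using v_inverse_\<pi> by (simp add: c_def)
    qed
  qed
next
  assume "semi_orthonormal A p Oc K n b"
  then have red: "\<And>c. \<forall>i<n. c i \<in> K \<Longrightarrow> (\<Sum>i<n. c i * b i) \<in> Op \<longleftrightarrow> (\<forall>i<n. c i * b i \<in> Op)"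
    and norm: "\<And>i. i < n \<Longrightarrow> b i \<in> Op" "\<And>i. i < n \<Longrightarrow> inverse \<pi> * b i \<notin> Op"
    unfolding semi_orthonormal_iff[OF n b] by blast+
  \<comment> \<open>If \<open>x\<close> has negative value, \<open>inverse \<pi> * inverse x\<close>
    lies in \<open>Ap\<close>; multiplying \<open>x * b i\<close> by it would make
    \<open>inverse \<pi> * b i\<close> integral.\<close>
  have coeff: "x \<in> Ap" if x: "x \<in> K" "x * b i \<in> Op" and i: "i < n" for x i
  proof (rule ccontr)
    assume nAp: "x \<notin> Ap"
    then have x0: "x \<noteq> 0" using subringD(1)[OF Ap] by auto
    have "v x < 0" using vr(2)[OF x(1) x0] nAp by simp
    moreover have inv: "inverse \<pi> \<in> K" "inverse x \<in> K" "v (inverse \<pi>) = - 1" "v (inverse x) = - v x"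
      using Kf(2) \<pi>_mem(2) x(1) vr(4)[OF x(1) x0] vr(4)[OF \<pi>_mem(2) \<pi>(2)] \<pi>(3) by auto
    ultimately have "0 \<le> v (inverse \<pi> * inverse x)"
      using vr(1)[OF inv(1,2)] x0 \<pi>(2) by simp
    then have "inverse \<pi> * inverse x \<in> Ap"
      using vr(2)[of "inverse \<pi> * inverse x"] Kr(5)[OF inv(1,2)] x0 \<pi>(2) by simp
    then have "inverse \<pi> * inverse x * (x * b i) \<in> Op" using x(2) by (rule Ap_Op_mult)
    moreover have "inverse \<pi> * inverse x * (x * b i) = inverse \<pi> * b i" using x0 by simp
    ultimately show False using norm(2)[OF i] by simp
  qed
  have coeffs: "c i \<in> Ap" if "\<forall>i<n. c i \<in> K" "(\<Sum>i<n. c i * b i) \<in> Op" "i < n" for c i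
    using red[of c] coeff[of "c i" i] that by blast
  \<comment> \<open>A vanishing sum stays integral after scaling by any \<open>y\<close> in
    \<open>K\<close>, so \<open>y * c i\<close> would always lie in \<open>Ap\<close>, which forces
    \<open>c i = 0\<close>.\<close>
  have indep: "c i = 0" if c: "\<forall>i<n. c i \<in> K" "(\<Sum>i<n. c i * b i) = 0" and i: "i < n" for c i
  proof (rule ccontr)
    assume "c i \<noteq> 0"
    then obtain y where y: "y \<in> K" "y * c i \<notin> Ap" using not_in_Ap_multiple c(1) i by blast
    have "(\<Sum>i<n. y * c i * b i) = 0" using c(2) by (simp add: mult.assoc flip: sum_distrib_left)
    then have "y * c i \<in> Ap" using c(1) y(1) Kr(5) i Opr(1) by (intro coeffs) auto
    then show False using y(2) by blast
  qed
  show "is_basis Ap Op n b"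
    unfolding is_basis_def
  proof (intro conjI allI impI ballI)
    show "b i \<in> Op" if "i < n" for i by (rule norm(1)[OF that])
    show "c i = 0" if "(\<forall>i<n. c i \<in> Ap) \<and> (\<Sum>i<n. c i * b i) = 0" "i < n" for c i
      using indep[of c i] that ApK by blast
    fix z assume z: "z \<in> Op"
    \<comment> \<open>Adjoining \<open>z\<close> at index \<open>n\<close> gives
      \<open>n + 1\<close> elements of \<open>L\<close>; independence of \<open>b\<close> makes the
      coefficient of \<open>z\<close> nonzero, so the relation can be solved for
      \<open>z\<close>.\<close>
    then have "lin_dep K {..n} (\<lambda>i. if i = n then z else b i)"
      using b by (intro dep) (auto simp: integral_closure_iff)
    then obtain c where c: "\<forall>i\<in>{..n}. c i \<in> K" "\<exists>i\<in>{..n}. c i \<noteq> 0"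
      "(\<Sum>i\<in>{..n}. c i * (if i = n then z else b i)) = 0"
      unfolding lin_dep_def by blast
    have "(\<Sum>i\<in>{..n}. c i * (if i = n then z else b i)) = c n * z + (\<Sum>i<n. c i * (if i = n then z else b i))"
      by (simp flip: lessThan_Suc_atMost)
    also have "(\<Sum>i<n. c i * (if i = n then z else b i)) = (\<Sum>i<n. c i * b i)" by (rule sum.cong) auto
    finally have eq: "c n * z + (\<Sum>i<n. c i * b i) = 0" using c(3) by simp
    have cn: "c n \<noteq> 0"
    proof
      assume cn: "c n = 0"
      then have "c i = 0" if "i < n" for i using indep[of c i] c(1) eq that by simp
      then show False using c(2) cn by (metis atMost_iff le_neq_implies_less)
    qed
    define d where "d i = - c i / c n" for i
    have dK: "\<forall>i<n. d i \<in> K" using c(1) unfolding d_def by (auto intro!: Kf(3) Kr(6))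
    have "(\<Sum>i<n. d i * b i) = - (\<Sum>i<n. c i * b i) / c n"
      by (simp add: d_def sum_divide_distrib sum_negf)
    also have "\<dots> = z" using eq cn by (simp add: field_simps add_eq_0_iff)
    finally have dz: "z = (\<Sum>i<n. d i * b i)" by simp
    then have "\<forall>i<n. d i \<in> Ap" using coeffs[OF dK] z by simp
    then show "\<exists>c. (\<forall>i<n. c i \<in> Ap) \<and> z = (\<Sum>i<n. c i * b i)" using dz by blast
  qed
qed

end

theorem mainTheorem12:
  fixes A p :: "'a::field set" and f :: "'a poly" and \<theta> :: 'a and b :: "nat \<Rightarrow> 'a"
    and K L Oc Op :: "'a set" and n :: nat
  defines "K \<equiv> frac_field A"
      and "L \<equiv> field_adjoin K \<theta>"
      and "Oc \<equiv> integral_closure A L"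
      and "Op \<equiv> integral_closure (localization A p) L"
      and "n \<equiv> degree f"
  assumes "dedekind_domain A"
      and "prime_ideal_of A p" and "p \<noteq> {0}"
      and "poly_over A f" and "lead_coeff f = 1"
      and "irreducible_over K f" and "coprime f (pderiv f)"
      and "poly f \<theta> = 0"
      and "\<forall>i<n. b i \<in> L"
  shows "is_basis (localization A p) Op n b \<longleftrightarrow> semi_orthonormal A p Oc K n b"
proof -
  note D = \<open>dedekind_domain A\<close> and p = \<open>prime_ideal_of A p\<close> \<open>p \<noteq> {0}\<close>
  have A: "subring A" and dim1: "\<And>Q. prime_ideal_of A Q \<Longrightarrow> Q \<noteq> {0} \<Longrightarrow> maximal_ideal_of A Q"
    using D by (auto simp: dedekind_domain_def)
  have K: "subfield K" unfolding K_def by (rule subfield_frac_field[OF A])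
  obtain v \<pi> where v: "dvaluation K (localization A p) v" "\<pi> \<in> p" "\<pi> \<noteq> 0" "v \<pi> = 1"
    using dedekind_localization_dvaluation[OF D p] unfolding K_def by blast
  have f: "poly_over K f" "degree f \<ge> 1"
    using \<open>irreducible_over K f\<close> by (auto simp: irreducible_over_def)
  interpret dedekind_ext A p K L Oc n v \<pi>
  proof
    show "subfield L" "K \<subseteq> L" unfolding L_def by (rule subfield_field_adjoin, rule subset_field_adjoin)
    show "lin_dep K J w" if "finite J" "card J > n" "\<And>j. j \<in> J \<Longrightarrow> w j \<in> L" for J :: "nat set" and w
      using field_adjoin_lin_dep[OF K f(1) \<open>lead_coeff f = 1\<close> f(2) \<open>poly f \<theta> = 0\<close>] that
      unfolding L_def n_def by blast
    show "x \<in> localization A p" if "x \<in> K" "integral_over (localization A p) x" for x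
      using dedekind_localization_integrally_closed[OF D p(1)] that unfolding K_def by blast
  qed (fact A p(1) dim1 v | simp add: K_def Oc_def)+
  show ?thesis
    unfolding Op_def by (rule is_basis_iff_semi_orthonormal) (use f(2) n_def \<open>\<forall>i<n. b i \<in> L\<close> in auto)
qed

end
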